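(* Let $\{\varphi_r\}_{0<r<1}$ be an arbitrary approximate identity on $\mathbb{T}$ (consisting of real-valued functions) with $c_\varphi>0$, where $$c_\varphi=\liminf_{r\to1}\frac1{\varphi_*(r)}\int_{-\mu(r)}^{\mu(r)}|\varphi_r(t)|\,dt,\qquad \mu(r)=\frac{\varphi_*(r)}{\|\varphi_r\|_\infty}.$$ Let $1<p<\infty$ and let $\lambda:(0,1)\to(0,\infty)$ be a function with $\lim_{r\to1}\lambda(r)=0$ satisfying $$\Pi_p(\lambda,\varphi):=\limsup_{r\to1}\lambda(r)\,\|\varphi_r\|_\infty\,\varphi_*(r)^{p-1}=\infty .$$ Then there exists a (real-valued) function $f\in L^p(\mathbb{T})$ such that $$\limsup_{\substack{r\to1\\ y\in\lambda(r,x)}}\Phi_r(y,f)=\infty\quad\text{for all }x\in\mathbb{T}.$$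
   Context: $\mathbb{T}=\mathbb{R}/2\pi\mathbb{Z}$ is the unit circle, with points represented by $[-\pi,\pi]$ (endpoints identified), Lebesgue measure $dt$, and $\|\cdot\|_q$ the norm of $L^q(\mathbb{T})$. An approximate identity is a family $\{\varphi_r\}_{0<r<1}\subset L^\infty(\mathbb{T})$ such that: ($\Phi1$) $\int_{\mathbb{T}}\varphi_r(t)\,dt\to1$ as $r\to1$; ($\Phi2$) $\varphi_r^*(x):=\sup_{|x|\le|t|\le\pi}|\varphi_r(t)|\to0$ as $r\to1$ for every $0<|x|\le\pi$; ($\Phi3$) $C_\varphi:=\sup_{0<r<1}\|\varphi_r^*\|_1<\infty$. Put $\varphi_*(r)=\sup_{x\in\mathbb{T}}|x\,\varphi_r^*(x)|$ and $\Phi_r(x,f)=\int_{\mathbb{T}}\varphi_r(x-t)f(t)\,dt$. $\lambda(r,x)$ denotes the interval $[x-\lambda(r),x+\lambda(r)]$ in $\mathbb{T}$, with $\lambda(r,x)=\mathbb{T}$ if $\lambda(r)\ge\pi$. The notation $\limsup_{r\to1,\ y\in\lambda(r,x)}F_r(y)$ means $\limsup_{r\to1}\sup_{y\in\lambda(r,x)}F_r(y)$. *)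

theory Defs
  imports "HOL-Probability.Essential_Supremum" "HOL-Library.Periodic_Fun"
begin

text \<open>
  Functions on the circle \<open>\<real>/2\<pi>\<int>\<close> are functions on \<open>\<real>\<close> with period \<open>2\<pi>\<close>; integrals and norms
  are taken over the representatives \<open>[-\<pi>, \<pi>]\<close>, whose two identified endpoints form a null set.
\<close>

definition circle :: "real measure" where
  "circle = lebesgue_on {-pi..pi}"

definition periodic :: "(real \<Rightarrow> real) \<Rightarrow> bool" where
  "periodic f \<longleftrightarrow> periodic_fun_simple f (2 * pi)"

definition norm_inf :: "(real \<Rightarrow> real) \<Rightarrow> ennreal" where
  "norm_inf f = esssup circle (\<lambda>t. ennreal \<bar>f t\<bar>)"

definition in_L_inf :: "(real \<Rightarrow> real) \<Rightarrow> bool" where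
  "in_L_inf f \<longleftrightarrow> periodic f \<and> f \<in> borel_measurable circle \<and> norm_inf f < \<infinity>"

definition in_L :: "real \<Rightarrow> (real \<Rightarrow> real) \<Rightarrow> bool" where
  "in_L p f \<longleftrightarrow> periodic f \<and> f \<in> borel_measurable circle \<and> integrable circle (\<lambda>t. \<bar>f t\<bar> powr p)"

text \<open>
  The majorant \<open>\<phi>\<^sup>*(x)\<close> of a kernel \<open>\<phi>\<close>, for \<open>x \<in> [-\<pi>, \<pi>]\<close>. The supremum is the pointwise one
  of the given representative, with values in \<open>[0, \<infinity>]\<close> because an element of \<open>L\<^sup>\<infinity>\<close> may be
  unbounded on a null set. The essential supremum is covered as well: replacing \<open>\<phi>(t)\<close> by \<open>0\<close> on the
  null set where \<open>\<bar>\<phi>(t)\<bar>\<close> exceeds the essential supremum of \<open>\<bar>\<phi>\<bar>\<close> over \<open>\<bar>t\<bar> \<le> \<bar>s\<bar> \<le> \<pi>\<close>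
  makes the two agree.
\<close>

definition majorant :: "(real \<Rightarrow> real) \<Rightarrow> real \<Rightarrow> ennreal" where
  "majorant \<phi> x = (SUP t\<in>{t. \<bar>x\<bar> \<le> \<bar>t\<bar> \<and> \<bar>t\<bar> \<le> pi}. ennreal \<bar>\<phi> t\<bar>)"

definition approximate_identity :: "(real \<Rightarrow> real \<Rightarrow> real) \<Rightarrow> bool" where
  "approximate_identity \<phi> \<longleftrightarrow>
     (\<forall>r\<in>{0<..<1}. in_L_inf (\<phi> r)) \<and>
     ((\<lambda>r. LINT t|circle. \<phi> r t) \<longlongrightarrow> 1) (at_left 1) \<and>
     (\<forall>x. 0 < \<bar>x\<bar> \<and> \<bar>x\<bar> \<le> pi \<longrightarrow> ((\<lambda>r. majorant (\<phi> r) x) \<longlongrightarrow> 0) (at_left 1)) \<and>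
     (SUP r\<in>{0<..<1}. \<integral>\<^sup>+ x. majorant (\<phi> r) x \<partial>circle) < \<infinity>"

text \<open>
  The quantity \<open>\<phi>\<^sub>*\<close>. For an approximate identity the supremum is finite, since
  \<open>2 \<bar>x\<bar> \<phi>\<^sup>*(x) \<le> \<parallel>\<phi>\<^sup>*\<parallel>\<^sub>1\<close> by monotonicity of \<open>\<phi>\<^sup>*\<close>, so \<open>enn2real\<close> loses nothing. For \<open>r\<close>
  near \<open>1\<close> both \<open>\<phi>\<^sub>*(r)\<close> and the sup norm of \<open>\<phi>\<^sub>r\<close> are positive, so the divisions below are
  genuine.
\<close>

definition phi_lower :: "(real \<Rightarrow> real) \<Rightarrow> real" where
  "phi_lower \<phi> = enn2real (SUP x\<in>{-pi..pi}. ennreal \<bar>x\<bar> * majorant \<phi> x)"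

definition mu :: "(real \<Rightarrow> real) \<Rightarrow> real" where
  "mu \<phi> = phi_lower \<phi> / enn2real (norm_inf \<phi>)"

definition c_const :: "(real \<Rightarrow> real \<Rightarrow> real) \<Rightarrow> ereal" where
  "c_const \<phi> = Liminf (at_left 1)
     (\<lambda>r. ereal (1 / phi_lower (\<phi> r) * (LINT t:{- mu (\<phi> r)..mu (\<phi> r)}|circle. \<bar>\<phi> r t\<bar>)))"

definition Pi_const :: "real \<Rightarrow> (real \<Rightarrow> real) \<Rightarrow> (real \<Rightarrow> real \<Rightarrow> real) \<Rightarrow> ereal" where
  "Pi_const p l \<phi> = Limsup (at_left 1)
     (\<lambda>r. ereal (l r * enn2real (norm_inf (\<phi> r)) * phi_lower (\<phi> r) powr (p - 1)))"

definition Phi :: "(real \<Rightarrow> real) \<Rightarrow> real \<Rightarrow> (real \<Rightarrow> real) \<Rightarrow> real" where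
  "Phi \<phi> x f = (LINT t|circle. \<phi> (x - t) * f t)"

text \<open>The preimage in \<open>\<real>\<close> of the arc, up to translation by multiples of \<open>2\<pi>\<close>.\<close>

definition arc_nbhd :: "real \<Rightarrow> real \<Rightarrow> real set" where
  "arc_nbhd l x = (if l \<ge> pi then UNIV else {x - l..x + l})"

end

theory Submission
  imports Defs
begin

text \<open>
  The proof is a gliding hump built on resonating combs.

  Fix \<open>r\<close> near \<open>1\<close> and write \<open>s = \<phi>\<^sub>*(r)\<close>, \<open>M = \<parallel>\<phi>\<^sub>r\<parallel>\<^sub>\<infinity>\<close>, \<open>m = \<mu>(r) = s / M\<close>. For
  \<open>0 < c < c\<^sub>\<phi>\<close> and \<open>r\<close> near \<open>1\<close>, \<open>\<bar>\<phi>\<^sub>r\<bar>\<close> has mass at least \<open>c s\<close> on \<open>[-m, m]\<close>. Copy the sign pattern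
  that \<open>\<phi>\<^sub>r\<close> has there, reflected, around every point of the lattice \<open>d \<int>\<close>, where \<open>d\<close> divides \<open>2\<pi>\<close> and is
  comparable to \<open>\<lambda>(r)\<close> but at most \<open>\<lambda>(r)\<close>. At a lattice point the tooth sitting
  there contributes at least \<open>c s\<close> to \<open>\<Phi>\<^sub>r\<close>, while the other teeth contribute at most
  a constant times \<open>m / d\<close>, because \<open>d \<Sum>\<^sub>k \<phi>\<^sub>r\<^sup>*(k d - d/2)\<close> is a lower Riemann sum of \<open>2 \<phi>\<^sub>r\<^sup>*\<close> on \<open>[0, \<pi>]\<close>
  (\<open>comb_function\<close>). The hypothesis on \<open>\<Pi>\<^sub>p\<close> lets us choose \<open>r\<close> with
  \<open>\<lambda>(r) M s\<^sup>p\<^sup>-\<^sup>1 > A\<close>, that is \<open>m / \<lambda>(r) < s\<^sup>p / A\<close>, arbitrarily close to \<open>1\<close> for any prescribed \<open>A\<close>; as \<open>s\<close> is bounded and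
  \<open>p > 1\<close>, this makes the other teeth negligible against \<open>c s\<close>. Scaled by \<open>h = 2 B / (c s)\<close> the comb
  reaches \<open>\<Phi>\<^sub>r \<ge> B\<close> on the whole lattice, hence within \<open>\<lambda>(r)\<close> of every point. Its support has measure
  of order \<open>m / d\<close>, so the \<open>p\<close>-th power of its \<open>L\<^sup>p\<close> norm is of order
  \<open>h\<^sup>p s\<^sup>p / A\<close>, which is of order \<open>B\<^sup>p / A\<close>: arbitrarily small for given \<open>B\<close>. So there are bounded functions, small in
  \<open>L\<^sup>1\<close> and \<open>L\<^sup>p\<close>, with large means near every point (\<open>exists_resonating_bump\<close>).

  Choose such functions \<open>g\<^sub>0, g\<^sub>1, \<dots>\<close> with parameters \<open>r\<^sub>k \<rightarrow> 1\<close> one after the other and put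
  \<open>f = \<Sum>\<^sub>k g\<^sub>k\<close>. The height \<open>B\<^sub>k\<close> is chosen to exceed by \<open>k + 1\<close> what the bounded functions chosen earlier can
  contribute to \<open>\<Phi>\<close>, namely the sum of the bounds \<open>\<parallel>g\<^sub>i\<parallel>\<^sub>\<infinity> \<parallel>\<phi>\<^sub>r\<parallel>\<^sub>1 \<le> C \<parallel>g\<^sub>i\<parallel>\<^sub>\<infinity>\<close>; and \<open>g\<^sub>k\<close> is so small in \<open>L\<^sup>1\<close> that its own contribution at the
  earlier parameters, at most \<open>\<parallel>\<phi>\<^sub>r\<parallel>\<^sub>\<infinity> \<parallel>g\<^sub>k\<parallel>\<^sub>1\<close>, is at most \<open>2\<^sup>-\<^sup>(\<^sup>k\<^sup>+\<^sup>1\<^sup>)\<close>. Hence \<open>\<Phi>(f) \<ge> k\<close> at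
  \<open>r\<^sub>k\<close> somewhere within \<open>\<lambda>(r\<^sub>k)\<close> of any given point.
\<close>

section \<open>Periodic functions on the circle\<close>

lemma periodic_shift:
  fixes f :: "real \<Rightarrow> 'a"
  assumes "\<And>x. f (x + T) = f x"
  shows "f (x + of_int n * T) = f x"
proof -
  interpret periodic_fun_simple f T
    by unfold_locales (rule assms)
  show ?thesis
    by (rule plus_of_int)
qed

text \<open>
  Countably many translates of one period cover the line, and translations preserve Lebesgue
  measurability. This transports measurability from the circle to the line, where reflections and
  translations are available.
\<close>

lemma periodic_lebesgue_measurable:
  fixes f :: "real \<Rightarrow> real"
  assumes T: "T > 0" and per: "\<And>x. f (x + T) = f x"
    and meas: "f \<in> borel_measurable (lebesgue_on {c..c + T})"
  shows "f \<in> borel_measurable lebesgue"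
proof -
  define w where "w x = (if x \<in> {c..c + T} then f x else 0)" for x
  have w: "w \<in> borel_measurable lebesgue"
    unfolding w_def using meas by (subst borel_measurable_if) auto
  define A where "A k = {c + of_int (int_decode k) * T..c + of_int (int_decode k) * T + T}" for k
  show ?thesis
  proof (rule measurable_piecewise_restrict2[where A = A])
    show "A k \<in> sets lebesgue" for k
      by (simp add: A_def)
    have "\<exists>k. x \<in> A k" for x
    proof
      have "of_int \<lfloor>(x - c) / T\<rfloor> \<le> (x - c) / T" "(x - c) / T \<le> of_int \<lfloor>(x - c) / T\<rfloor> + 1"
        by linarith+
      then have "of_int \<lfloor>(x - c) / T\<rfloor> * T \<le> x - c" "x - c \<le> (of_int \<lfloor>(x - c) / T\<rfloor> + 1) * T"
        using T by (simp_all only: pos_le_divide_eq pos_divide_le_eq)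
      then show "x \<in> A (int_encode \<lfloor>(x - c) / T\<rfloor>)"
        by (auto simp: A_def algebra_simps)
    qed
    then show "space lebesgue = (\<Union>k. A k)"
      by auto
    show "\<exists>h\<in>borel_measurable lebesgue. \<forall>x\<in>A k. f x = h x" for k
    proof (rule bexI)
      let ?s = "- of_int (int_decode k) * T"
      show "(\<lambda>x. w (?s + 1 *\<^sub>R x)) \<in> borel_measurable lebesgue"
        by (rule borel_measurable_affine[OF w]) simp
      show "\<forall>x\<in>A k. f x = w (?s + 1 *\<^sub>R x)"
      proof
        fix x assume "x \<in> A k"
        then have "?s + x \<in> {c..c + T}"
          by (auto simp: A_def)
        then show "f x = w (?s + 1 *\<^sub>R x)"
          using periodic_shift[of f T x "- int_decode k"] per by (auto simp: w_def add.commute)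
      qed
    qed
  qed
qed

lemma nn_integral_circle:
  "(\<integral>\<^sup>+t. F t \<partial>circle) = (\<integral>\<^sup>+t. F t * indicator {-pi..pi} t \<partial>lebesgue)"
  unfolding circle_def by (rule nn_integral_restrict_space) simp

lemma nn_integral_lebesgue_translate:
  fixes F :: "real \<Rightarrow> ennreal"
  assumes "F \<in> borel_measurable lebesgue"
  shows "(\<integral>\<^sup>+t. F (s + t) \<partial>lebesgue) = (\<integral>\<^sup>+t. F t \<partial>lebesgue)"
  using nn_integral_real_affine_lebesgue[OF assms, of 1 s] by simp

text \<open>
  Cut \<open>[a, a + T)\<close> at the multiple \<open>b\<close> of \<open>T\<close> that it contains and move the left piece by one
  period: together the pieces fill \<open>[b, b + T)\<close>, a translate of \<open>[0, T)\<close> by a multiple of the period.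
\<close>

lemma nn_integral_period:
  fixes F :: "real \<Rightarrow> ennreal"
  assumes T: "T > 0" and per: "\<And>x. F (x + T) = F x"
    and [measurable]: "F \<in> borel_measurable lebesgue"
  shows "(\<integral>\<^sup>+t. F t * indicator {a..<a + T} t \<partial>lebesgue) = (\<integral>\<^sup>+t. F t * indicator {0..<T} t \<partial>lebesgue)"
proof -
  have [measurable]: "(\<lambda>t. F t * indicator {u..<v} t) \<in> borel_measurable lebesgue" for u v
    by (intro borel_measurable_times_ennreal borel_measurable_indicator) auto
  define J where "J u v = (\<integral>\<^sup>+t. F t * indicator {u..<v} t \<partial>lebesgue)" for u v
  have shift: "J (u + of_int n * T) (v + of_int n * T) = J u v" for u v n
  proof -
    have "J (u + of_int n * T) (v + of_int n * T) =
        (\<integral>\<^sup>+t. F (of_int n * T + t) * indicator {u + of_int n * T..<v + of_int n * T} (of_int n * T + t) \<partial>lebesgue)"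
      unfolding J_def
      by (subst nn_integral_lebesgue_translate[of "\<lambda>t. F t * indicator {u + of_int n * T..<v + of_int n * T} t"]) auto
    also have "\<dots> = J u v"
      unfolding J_def
      by (intro nn_integral_cong)
        (auto simp: indicator_def periodic_shift[of F, OF per] add.commute[of "of_int n * T"])
    finally show ?thesis .
  qed
  have split: "J u w = J u v + J v w" if "u \<le> v" "v \<le> w" for u v w
    unfolding J_def using that
    by (subst nn_integral_add[symmetric])
      (auto intro!: nn_integral_cong split: split_indicator simp flip: distrib_left)
  define b where "b = of_int \<lceil>a / T\<rceil> * T"
  have "a / T \<le> of_int \<lceil>a / T\<rceil>" "of_int \<lceil>a / T\<rceil> \<le> a / T + 1"
    by linarith+
  then have "a / T * T \<le> b" "b \<le> (a / T + 1) * T"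
    unfolding b_def using T by (intro mult_right_mono; simp)+
  then have ab: "a \<le> b" "b \<le> a + T"
    using T by (simp_all add: algebra_simps)
  have "J a (a + T) = J a b + J b (a + T)"
    using ab by (rule split)
  also have "J a b = J (a + T) (b + T)"
    using shift[of a 1 b] by simp
  also have "J (a + T) (b + T) + J b (a + T) = J b (b + T)"
    using split[of b "a + T" "b + T"] ab by (simp add: add.commute)
  also have "\<dots> = J 0 T"
    using shift[of 0 "\<lceil>a / T\<rceil>" T] by (simp add: b_def add.commute)
  finally show ?thesis
    by (simp add: J_def)
qed

lemma nn_integral_circle_reflect:
  fixes F :: "real \<Rightarrow> ennreal"
  assumes per: "\<And>x. F (x + 2 * pi) = F x"
    and F [measurable]: "F \<in> borel_measurable lebesgue"
  shows "(\<integral>\<^sup>+t. F (y - t) \<partial>circle) = (\<integral>\<^sup>+t. F t \<partial>circle)"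
proof -
  have closed: "(\<integral>\<^sup>+t. F t * indicator {a..a + 2 * pi} t \<partial>lebesgue) =
      (\<integral>\<^sup>+t. F t * indicator {0..<2 * pi} t \<partial>lebesgue)" for a
  proof -
    have "AE t in lebesgue. t \<noteq> a + 2 * pi"
      by (intro AE_completion AE_lborel_singleton)
    then have "(\<integral>\<^sup>+t. F t * indicator {a..a + 2 * pi} t \<partial>lebesgue) =
        (\<integral>\<^sup>+t. F t * indicator {a..<a + 2 * pi} t \<partial>lebesgue)"
      by (intro nn_integral_cong_AE) (auto simp: indicator_def)
    then show ?thesis
      using nn_integral_period[of "2 * pi" F a] per by simp
  qed
  have "(\<integral>\<^sup>+t. F (y - t) \<partial>circle) =
      (\<integral>\<^sup>+t. F (y + -1 * t) * indicator {y - pi..y + pi} (y + -1 * t) \<partial>lebesgue)"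
    unfolding nn_integral_circle by (intro nn_integral_cong) (auto simp: indicator_def)
  also have "\<dots> = (\<integral>\<^sup>+t. F t * indicator {y - pi..y + pi} t \<partial>lebesgue)"
    by (subst nn_integral_real_affine_lebesgue[of "\<lambda>t. F t * indicator {y - pi..y + pi} t" "-1" y])
      (auto intro!: borel_measurable_times_ennreal borel_measurable_indicator)
  also have "\<dots> = (\<integral>\<^sup>+t. F t \<partial>circle)"
    unfolding nn_integral_circle
    using closed[of "y - pi"] closed[of "-pi"] by (simp add: algebra_simps)
  finally show ?thesis .
qed

lemma circle_measurable:
  "f \<in> borel_measurable lebesgue \<Longrightarrow> f \<in> borel_measurable circle"
  unfolding circle_def by (rule measurable_restrict_space1)

lemma lebesgue_measurable_reflect:
  "(f :: real \<Rightarrow> real) \<in> borel_measurable lebesgue \<Longrightarrow> (\<lambda>t. f (y - t)) \<in> borel_measurable lebesgue"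
  using borel_measurable_affine[of f "-1" y] by simp

text \<open>
  Positive part, negative part and absolute value of the integrand are nonnegative periodic functions, so each is
  covered by \<open>nn_integral_circle_reflect\<close>.
\<close>

lemma integral_circle_reflect:
  fixes F :: "real \<Rightarrow> real"
  assumes per: "\<And>x. F (x + 2 * pi) = F x"
    and F [measurable]: "F \<in> borel_measurable lebesgue"
    and int: "integrable circle F"
  shows "(LINT t|circle. F (y - t)) = (LINT t|circle. F t)"
proof -
  have 1: "(\<integral>\<^sup>+t. ennreal (F (y - t)) \<partial>circle) = (\<integral>\<^sup>+t. ennreal (F t) \<partial>circle)"
    by (rule nn_integral_circle_reflect[of "\<lambda>t. ennreal (F t)"]) (simp_all add: per)
  have 2: "(\<integral>\<^sup>+t. ennreal (- F (y - t)) \<partial>circle) = (\<integral>\<^sup>+t. ennreal (- F t) \<partial>circle)"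
    by (rule nn_integral_circle_reflect[of "\<lambda>t. ennreal (- F t)"]) (simp_all add: per)
  have 3: "(\<integral>\<^sup>+t. ennreal (norm (F (y - t))) \<partial>circle) = (\<integral>\<^sup>+t. ennreal (norm (F t)) \<partial>circle)"
    by (rule nn_integral_circle_reflect[of "\<lambda>t. ennreal (norm (F t))"]) (simp_all add: per)
  have "integrable circle (\<lambda>t. F (y - t))"
    using int 3 circle_measurable[OF lebesgue_measurable_reflect[OF F, of y]]
    by (simp add: integrable_iff_bounded)
  then show ?thesis
    using int 1 2 by (simp add: real_lebesgue_integral_def)
qed

section \<open>The radially decreasing majorant\<close>

lemma majorant_antimono: "\<bar>x\<bar> \<le> \<bar>y\<bar> \<Longrightarrow> majorant f y \<le> majorant f x"
  unfolding majorant_def by (rule SUP_subset_mono) auto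

lemma le_majorant: "\<bar>x\<bar> \<le> \<bar>t\<bar> \<Longrightarrow> \<bar>t\<bar> \<le> pi \<Longrightarrow> ennreal \<bar>f t\<bar> \<le> majorant f x"
  unfolding majorant_def by (rule SUP_upper) simp

lemma majorant_beyond: "\<bar>x\<bar> > pi \<Longrightarrow> majorant f x = 0"
proof -
  assume "\<bar>x\<bar> > pi"
  then have "{t. \<bar>x\<bar> \<le> \<bar>t\<bar> \<and> \<bar>t\<bar> \<le> pi} = {}"
    by auto
  then show ?thesis
    by (simp only: majorant_def image_empty Sup_empty bot_ennreal)
qed

text \<open>
  A lower Riemann sum: the interval \<open>I k\<close> of length \<open>d / 2\<close> ends at the node \<open>k d - d / 2\<close>, so the
  majorant is at least its value at the node on \<open>I k\<close>, and these intervals are disjoint. Nodes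
  beyond \<open>\<pi>\<close> are harmless, as the majorant is a supremum over the empty set there.
\<close>

lemma majorant_riemann_sum:
  fixes d :: real
  assumes d: "d > 0"
  shows "(\<Sum>k = 1..N. majorant f (real k * d - d / 2) * ennreal (d / 2)) \<le> (\<integral>\<^sup>+x. majorant f x \<partial>circle)"
proof -
  define I where "I k = {(real k - 1) * d..<real k * d - d / 2}" for k
  define a where "a k = majorant f (real k * d - d / 2)" for k
  have "(\<Sum>k = 1..N. a k * ennreal (d / 2)) = (\<Sum>k = 1..N. \<integral>\<^sup>+x. a k * indicator (I k) x \<partial>lebesgue)"
  proof (intro sum.cong refl)
    fix k
    have "emeasure lebesgue (I k) = ennreal (d / 2)"
      using d by (simp add: I_def algebra_simps)
    then show "a k * ennreal (d / 2) = (\<integral>\<^sup>+x. a k * indicator (I k) x \<partial>lebesgue)"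
      by (subst nn_integral_cmult_indicator) (auto simp: I_def)
  qed
  also have "\<dots> = (\<integral>\<^sup>+x. (\<Sum>k = 1..N. a k * indicator (I k) x) \<partial>lebesgue)"
    by (rule nn_integral_sum[symmetric]) (auto simp: I_def intro!: borel_measurable_times_ennreal borel_measurable_indicator)
  also have "\<dots> \<le> (\<integral>\<^sup>+x. majorant f x * indicator {-pi..pi} x \<partial>lebesgue)"
  proof (rule nn_integral_mono)
    fix x
    show "(\<Sum>k = 1..N. a k * indicator (I k) x) \<le> majorant f x * indicator {-pi..pi} x"
    proof (cases "\<exists>k\<in>{1..N}. x \<in> I k")
      case False
      then show ?thesis by (simp add: indicator_def)
    next
      case True
      then obtain k where k: "k \<in> {1..N}" "x \<in> I k"
        by auto
      have unique: "j = k" if "x \<in> I j" for j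
      proof -
        have "(real j - 1) * d < (real k - 1 / 2) * d" "(real k - 1) * d < (real j - 1 / 2) * d"
          using that k(2) by (auto simp: I_def algebra_simps)
        then have "real j - 1 < real k - 1 / 2" "real k - 1 < real j - 1 / 2"
          using d by (simp_all only: mult_less_cancel_right_pos)
        then show ?thesis by linarith
      qed
      have "(\<Sum>j = 1..N. a j * indicator (I j) x) = (\<Sum>j = 1..N. if j = k then a k else 0)"
      proof (intro sum.cong refl)
        fix j
        show "a j * indicator (I j) x = (if j = k then a k else 0)"
          using k(2) unique[of j] by (cases "j = k") (simp, force)
      qed
      also have "\<dots> = a k"
        using k by simp
      also have "\<dots> \<le> majorant f x * indicator {-pi..pi} x"
      proof (cases "real k * d - d / 2 \<le> pi")
        case True
        have "0 \<le> (real k - 1) * d"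
          using k d by auto
        then have "0 \<le> x" "x \<le> real k * d - d / 2"
          using k(2) unfolding I_def by auto
        then show ?thesis
          using True pi_gt_zero unfolding a_def by (auto simp: indicator_def intro!: majorant_antimono)
      next
        case False
        then show ?thesis unfolding a_def by (simp add: majorant_beyond)
      qed
      finally show ?thesis .
    qed
  qed
  also have "\<dots> = (\<integral>\<^sup>+x. majorant f x \<partial>circle)"
    by (simp add: nn_integral_circle)
  finally show ?thesis
    by (simp add: a_def)
qed

lemma nn_integral_le_majorant:
  "(\<integral>\<^sup>+t. ennreal \<bar>f t\<bar> \<partial>circle) \<le> (\<integral>\<^sup>+t. majorant f t \<partial>circle)"
  by (rule nn_integral_mono) (auto simp: circle_def intro!: le_majorant)

lemma in_L_inf_periodic: "in_L_inf f \<Longrightarrow> f (x + 2 * pi) = f x"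
  by (simp add: in_L_inf_def periodic_def periodic_fun_simple.plus_period)

lemma in_L_inf_lebesgue_measurable: "in_L_inf f \<Longrightarrow> f \<in> borel_measurable lebesgue"
  by (rule periodic_lebesgue_measurable[where T = "2 * pi" and c = "-pi"])
    (auto simp: in_L_inf_periodic in_L_inf_def circle_def)

section \<open>Combs\<close>

definition lattice_offset :: "real \<Rightarrow> real \<Rightarrow> real" where
  "lattice_offset d t = t - of_int (round (t / d)) * d"

lemma lattice_offset_shift: "d > 0 \<Longrightarrow> lattice_offset d (t + of_int j * d) = lattice_offset d t"
proof -
  assume d: "d > 0"
  have "(t + of_int j * d) / d = t / d + of_int j"
    using d by (simp add: field_simps)
  moreover have "round (t / d + of_int j) = round (t / d) + j"
    unfolding round_def by linarith
  ultimately show ?thesis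
    by (simp add: lattice_offset_def algebra_simps)
qed

lemma lattice_offset_eq_self: "d > 0 \<Longrightarrow> \<bar>t\<bar> < d / 2 \<Longrightarrow> lattice_offset d t = t"
proof -
  assume "d > 0" "\<bar>t\<bar> < d / 2"
  then have "round (t / d) = 0"
    by (intro round_unique') (simp add: abs_divide field_simps)
  then show ?thesis by (simp add: lattice_offset_def)
qed

text \<open>
  On the circle the lattice neighbourhoods are symmetric under \<open>t \<mapsto> -t\<close>, so they are described by shells in
  \<open>\<bar>t\<bar>\<close> around the nonnegative lattice points; rounding yields at most \<open>N / 2 + 1 / 2 \<le> N\<close> as an index.
  The shell of index \<open>0\<close> is the central tooth.
\<close>

lemma lattice_offset_small_cases:
  fixes N :: nat
  assumes N: "N \<ge> 1" and d: "d = 2 * pi / real N"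
    and t: "\<bar>t\<bar> \<le> pi" "\<bar>lattice_offset d t\<bar> \<le> m"
  obtains k where "k \<le> N" "\<bar>\<bar>t\<bar> - real k * d\<bar> \<le> m" "k = 0 \<Longrightarrow> \<bar>t\<bar> \<le> m"
proof
  define n where "n = round (t / d)"
  define k where "k = nat \<bar>n\<bar>"
  have "d > 0" using N d by simp
  have "\<bar>t / d\<bar> \<le> pi / d"
    using t \<open>d > 0\<close> by (simp add: abs_divide divide_right_mono)
  moreover have "pi / d = real N / 2"
    using N d by simp
  moreover have "\<bar>real_of_int n - t / d\<bar> \<le> 1 / 2"
    unfolding n_def by (rule of_int_round_abs_le)
  ultimately have "\<bar>real_of_int n\<bar> \<le> real N / 2 + 1 / 2"
    by linarith
  also have "\<dots> \<le> real N"
    using N by simp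
  finally show "k \<le> N"
    unfolding k_def by linarith
  have k: "real k * d = \<bar>of_int n * d\<bar>"
    using \<open>d > 0\<close> by (simp add: k_def abs_mult)
  have "\<bar>\<bar>t\<bar> - real k * d\<bar> \<le> \<bar>t - of_int n * d\<bar>"
    unfolding k by linarith
  also have "\<dots> \<le> m"
    using t by (simp add: lattice_offset_def n_def)
  finally show *: "\<bar>\<bar>t\<bar> - real k * d\<bar> \<le> m" .
  then show "\<bar>t\<bar> \<le> m" if "k = 0"
    using that by simp
qed

lemma emeasure_symmetric_shell:
  assumes "0 \<le> m"
  shows "{t. \<bar>\<bar>t\<bar> - c\<bar> \<le> m} \<in> sets lebesgue" "emeasure lebesgue {t. \<bar>\<bar>t\<bar> - c\<bar> \<le> m} \<le> ennreal (4 * m)"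
proof -
  have "{t. \<bar>\<bar>t\<bar> - c\<bar> \<le> m} = {t \<in> space borel. \<bar>\<bar>t\<bar> - c\<bar> \<le> m}"
    by simp
  also have "\<dots> \<in> sets borel"
    by measurable
  finally show sets: "{t. \<bar>\<bar>t\<bar> - c\<bar> \<le> m} \<in> sets lebesgue"
    by simp
  have "emeasure lebesgue {t. \<bar>\<bar>t\<bar> - c\<bar> \<le> m} \<le> emeasure lebesgue ({c - m..c + m} \<union> {-c - m..-c + m})"
    by (rule emeasure_mono) auto
  also have "\<dots> \<le> emeasure lebesgue {c - m..c + m} + emeasure lebesgue {-c - m..-c + m}"
    by (rule emeasure_subadditive) auto
  also have "\<dots> = ennreal (4 * m)"
    using assms by (simp flip: ennreal_plus)
  finally show "emeasure lebesgue {t. \<bar>\<bar>t\<bar> - c\<bar> \<le> m} \<le> ennreal (4 * m)" .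
qed

text \<open>
  The comb repeats the reflected signs of \<open>f\<close> on \<open>[-m, m]\<close> around all lattice points. Since it has period \<open>d\<close>,
  its convolution with \<open>f\<close> takes the same value at all lattice points, namely the integral of
  \<open>f t * q t\<close> with \<open>q\<close> the unreflected comb. The central tooth of \<open>q\<close> produces the integral of \<open>\<bar>f\<bar>\<close> over \<open>[-m, m]\<close>. On
  the \<open>k\<close>-th tooth \<open>\<bar>f\<bar>\<close> is at most the majorant at \<open>k d - d / 2\<close>, and the two teeth with index
  \<open>\<plusminus>k\<close> have total length \<open>4 m\<close>, so that the Riemann sum bounds the loss.
\<close>

lemma comb_function:
  fixes f :: "real \<Rightarrow> real" and N :: nat
  assumes f: "in_L_inf f" and C: "0 \<le> C" "(\<integral>\<^sup>+x. majorant f x \<partial>circle) \<le> ennreal C"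
    and N: "N \<ge> 1" and d: "d = 2 * pi / real N" and m: "0 \<le> m" "m < d / 2"
  obtains g :: "real \<Rightarrow> real" where
    "\<And>t. g (t + 2 * pi) = g t" "g \<in> borel_measurable lebesgue" "\<And>t. \<bar>g t\<bar> \<le> 1"
    "(\<integral>\<^sup>+t. indicator {t. g t \<noteq> 0} t \<partial>circle) \<le> ennreal (8 * m * real N)"
    "\<And>j. Phi f (of_int j * d) g \<ge> (LINT t:{-m..m}|circle. \<bar>f t\<bar>) - 8 * m * C / d"
proof -
  have [measurable]: "f \<in> borel_measurable lebesgue"
    using f by (rule in_L_inf_lebesgue_measurable)
  have d0: "d > 0" and dN: "real N * d = 2 * pi"
    using N d by simp_all
  define q where "q s = (if \<bar>lattice_offset d s\<bar> \<le> m then sgn (f (lattice_offset d s)) else 0)" for s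
  have q_shift: "q (s + of_int j * d) = q s" for s j
    by (simp add: q_def lattice_offset_shift d0)
  have q_shift1: "q (s + d) = q s" for s
    using q_shift[of s 1] by simp
  have q_per: "q (s + 2 * pi) = q s" for s
    using q_shift[of s "int N"] dN by simp
  have q_le: "\<bar>q s\<bar> \<le> 1" for s
    by (simp add: q_def sgn_if)
  have q_center: "q s = sgn (f s)" if "\<bar>s\<bar> \<le> m" for s
    using that m d0 by (simp add: q_def lattice_offset_eq_self)
  have q_edge: "q s = 0" if "m < \<bar>s\<bar>" "\<bar>s\<bar> < d / 2" for s
    using that d0 by (simp add: q_def lattice_offset_eq_self)
  \<comment> \<open>at the end points of the period cell both sides vanish, because \<open>m < d / 2\<close>\<close>
  have q_half: "q s = (if \<bar>s\<bar> \<le> m then sgn (f s) else 0)" if "s \<in> {-d / 2..-d / 2 + d}" for s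
  proof (cases "\<bar>s\<bar> < d / 2")
    case True
    then show ?thesis using q_center q_edge by auto
  next
    case False
    then have "\<bar>s\<bar> = d / 2"
      using that by auto
    have "(d / 2) / d = 1 / 2" "(- (d / 2)) / d = - 1 / 2"
      using d0 by auto
    then have "\<bar>lattice_offset d s\<bar> = d / 2"
      using \<open>\<bar>s\<bar> = d / 2\<close> d0 by (auto simp: lattice_offset_def round_def abs_if split: if_splits)
    then show ?thesis using \<open>\<bar>s\<bar> = d / 2\<close> m by (simp add: q_def)
  qed
  have q_meas [measurable]: "q \<in> borel_measurable lebesgue"
  proof (rule periodic_lebesgue_measurable[where T = d and c = "- d / 2"])
    show "d > 0" "\<And>s. q (s + d) = q s"
      by (fact d0 q_shift1)+
    have "(\<lambda>s. if \<bar>s\<bar> \<le> m then sgn (f s) else 0) \<in> borel_measurable lebesgue"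
    proof -
      have "{-m..m} \<in> sets lebesgue" by simp
      then have "(\<lambda>s. indicator {-m..m} s * sgn (f s)) \<in> borel_measurable lebesgue"
        by (intro borel_measurable_times borel_measurable_indicator) auto
      then show ?thesis
        by (rule measurable_cong[THEN iffD1, rotated]) (auto simp: indicator_def)
    qed
    then have "(\<lambda>s. if \<bar>s\<bar> \<le> m then sgn (f s) else 0) \<in> borel_measurable (lebesgue_on {-d / 2..-d / 2 + d})"
      by (rule measurable_restrict_space1)
    then show "q \<in> borel_measurable (lebesgue_on {-d / 2..-d / 2 + d})"
      by (rule measurable_cong[THEN iffD1, rotated]) (use q_half in auto)
  qed
  define S where "S k = {t. \<bar>\<bar>t\<bar> - real k * d\<bar> \<le> m}" for k
  have S: "S k \<in> sets lebesgue" "emeasure lebesgue (S k) \<le> ennreal (4 * m)" for k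
    unfolding S_def using emeasure_symmetric_shell[OF m(1)] by auto
  have S_circle: "S k \<inter> {-pi..pi} \<in> sets circle" "emeasure circle (S k \<inter> {-pi..pi}) \<le> ennreal (4 * m)" for k
  proof -
    show "S k \<inter> {-pi..pi} \<in> sets circle"
      using S(1)[of k] by (auto simp: circle_def sets_restrict_space)
    have "emeasure circle (S k \<inter> {-pi..pi}) = emeasure lebesgue (S k \<inter> {-pi..pi})"
      unfolding circle_def by (rule emeasure_restrict_space) auto
    also have "\<dots> \<le> emeasure lebesgue (S k)"
      using S(1)[of k] by (intro emeasure_mono) auto
    finally show "emeasure circle (S k \<inter> {-pi..pi}) \<le> ennreal (4 * m)"
      using S(2)[of k] by simp
  qed
  have space_circle: "space circle = {-pi..pi}"
    by (simp add: circle_def)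
  have q_support: "\<exists>k\<le>N. t \<in> S k \<inter> {-pi..pi} \<and> (k = 0 \<longrightarrow> \<bar>t\<bar> \<le> m)" if "q t \<noteq> 0" "t \<in> {-pi..pi}" for t
  proof -
    have "\<bar>lattice_offset d t\<bar> \<le> m" "\<bar>t\<bar> \<le> pi"
      using that by (auto simp: q_def split: if_splits)
    then obtain k where "k \<le> N" "\<bar>\<bar>t\<bar> - real k * d\<bar> \<le> m" "k = 0 \<Longrightarrow> \<bar>t\<bar> \<le> m"
      using lattice_offset_small_cases[OF N d, of t m] by metis
    then show ?thesis
      using that unfolding S_def by blast
  qed
  have f_int: "integrable circle f"
  proof (rule integrableI_bounded)
    show "f \<in> borel_measurable circle"
      by (rule circle_measurable) simp
    have "(\<integral>\<^sup>+t. ennreal (norm (f t)) \<partial>circle) \<le> ennreal C"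
      using nn_integral_le_majorant[of f] C(2) by simp
    then show "(\<integral>\<^sup>+t. ennreal (norm (f t)) \<partial>circle) < \<infinity>"
      by (simp add: le_less_trans)
  qed
  have q_circle: "q \<in> borel_measurable circle"
    by (rule circle_measurable) simp
  have fq_int: "integrable circle (\<lambda>t. f t * q t)"
  proof (rule Bochner_Integration.integrable_bound[OF f_int])
    show "(\<lambda>t. f t * q t) \<in> borel_measurable circle"
      using f_int q_circle by simp
    show "AE t in circle. norm (f t * q t) \<le> norm (f t)"
      using q_le by (auto simp: abs_mult mult_left_le)
  qed
  \<comment> \<open>the noncentral teeth\<close>
  define E where "E = {t. q t \<noteq> 0 \<and> m < \<bar>t\<bar>} \<inter> {-pi..pi}"
  have m_sets: "{-m..m} \<inter> {-pi..pi} \<in> sets circle"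
    by (auto simp: circle_def sets_restrict_space)
  have E_sets: "E \<in> sets circle"
  proof -
    have "E = {t \<in> space circle. q t \<noteq> 0} - ({-m..m} \<inter> {-pi..pi})"
      by (auto simp: E_def space_circle)
    moreover have "{t \<in> space circle. q t \<noteq> 0} \<in> sets circle"
      using q_circle by measurable
    ultimately show ?thesis using m_sets by auto
  qed
  have fE: "(\<integral>\<^sup>+t. ennreal (\<bar>f t\<bar> * indicator E t) \<partial>circle) \<le> ennreal (8 * m * C / d)"
  proof -
    define a where "a k = majorant f (real k * d - d / 2)" for k
    have "(\<integral>\<^sup>+t. ennreal (\<bar>f t\<bar> * indicator E t) \<partial>circle) \<le>
        (\<integral>\<^sup>+t. (\<Sum>k = 1..N. a k * indicator (S k \<inter> {-pi..pi}) t) \<partial>circle)"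
    proof (rule nn_integral_mono)
      fix t
      show "ennreal (\<bar>f t\<bar> * indicator E t) \<le> (\<Sum>k = 1..N. a k * indicator (S k \<inter> {-pi..pi}) t)"
      proof (cases "t \<in> E")
        case True
        then obtain k where k: "k \<le> N" "t \<in> S k \<inter> {-pi..pi}" "k \<noteq> 0"
          using q_support[of t] by (auto simp: E_def)
        have "0 \<le> (real k - 1 / 2) * d"
          using k d0 by simp
        then have "\<bar>real k * d - d / 2\<bar> \<le> \<bar>t\<bar>"
          using k(2) m by (auto simp: S_def algebra_simps)
        then have "ennreal (\<bar>f t\<bar> * indicator E t) \<le> a k * indicator (S k \<inter> {-pi..pi}) t"
          using True k(2) unfolding a_def by (auto intro!: le_majorant)
        also have "\<dots> \<le> (\<Sum>k = 1..N. a k * indicator (S k \<inter> {-pi..pi}) t)"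
          using k by (intro member_le_sum) auto
        finally show ?thesis .
      qed simp
    qed
    also have "\<dots> = (\<Sum>k = 1..N. a k * emeasure circle (S k \<inter> {-pi..pi}))"
      using S_circle(1) by (subst nn_integral_sum) (auto simp: nn_integral_cmult_indicator)
    also have "\<dots> \<le> (\<Sum>k = 1..N. a k * ennreal (4 * m))"
      using S_circle(2) by (intro sum_mono mult_left_mono) auto
    also have "\<dots> = (\<Sum>k = 1..N. a k * ennreal (d / 2) * ennreal (8 * m / d))"
      using d0 m by (intro sum.cong refl) (simp add: mult.assoc flip: ennreal_mult)
    also have "\<dots> = (\<Sum>k = 1..N. a k * ennreal (d / 2)) * ennreal (8 * m / d)"
      by (simp add: sum_distrib_right)
    also have "\<dots> \<le> ennreal C * ennreal (8 * m / d)"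
      using majorant_riemann_sum[OF d0, of f N] C(2) unfolding a_def by (intro mult_right_mono) auto
    also have "\<dots> = ennreal (8 * m * C / d)"
      using C d0 m by (simp add: mult.commute flip: ennreal_mult)
    finally show ?thesis .
  qed
  have fE_int: "integrable circle (\<lambda>t. \<bar>f t\<bar> * indicator E t)"
    using integrable_mult_indicator[OF E_sets integrable_abs[OF f_int]] by (simp add: mult.commute)
  have "(LINT t|circle. \<bar>f t\<bar> * indicator E t) \<le> 8 * m * C / d"
  proof -
    have "ennreal (LINT t|circle. \<bar>f t\<bar> * indicator E t) = (\<integral>\<^sup>+t. ennreal (\<bar>f t\<bar> * indicator E t) \<partial>circle)"
      by (rule nn_integral_eq_integral[OF fE_int, symmetric]) auto
    then have "ennreal (LINT t|circle. \<bar>f t\<bar> * indicator E t) \<le> ennreal (8 * m * C / d)"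
      using fE by simp
    moreover have "0 \<le> 8 * m * C / d"
      using C d0 m by simp
    ultimately show ?thesis
      by (simp only: ennreal_le_iff)
  qed
  moreover have "(LINT t:{-m..m}|circle. \<bar>f t\<bar>) - (LINT t|circle. \<bar>f t\<bar> * indicator E t) \<le> (LINT t|circle. f t * q t)"
  proof -
    have int_m: "integrable circle (\<lambda>t. indicator {-m..m} t *\<^sub>R \<bar>f t\<bar>)"
    proof -
      have "integrable circle (\<lambda>t. indicator ({-m..m} \<inter> {-pi..pi}) t *\<^sub>R \<bar>f t\<bar>)"
        by (rule integrable_mult_indicator[OF m_sets integrable_abs[OF f_int]])
      moreover have "integrable circle (\<lambda>t. indicator ({-m..m} \<inter> {-pi..pi}) t *\<^sub>R \<bar>f t\<bar>) \<longleftrightarrow> ?thesis"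
        by (rule Bochner_Integration.integrable_cong) (auto simp: space_circle indicator_def)
      ultimately show ?thesis
        by simp
    qed
    have "(LINT t:{-m..m}|circle. \<bar>f t\<bar>) - (LINT t|circle. \<bar>f t\<bar> * indicator E t) =
        (LINT t|circle. indicator {-m..m} t *\<^sub>R \<bar>f t\<bar> - \<bar>f t\<bar> * indicator E t)"
      unfolding set_lebesgue_integral_def using int_m fE_int by simp
    also have "\<dots> \<le> (LINT t|circle. f t * q t)"
    proof (rule integral_mono)
      show "integrable circle (\<lambda>t. indicator {-m..m} t *\<^sub>R \<bar>f t\<bar> - \<bar>f t\<bar> * indicator E t)"
        using int_m fE_int by simp
      show "integrable circle (\<lambda>t. f t * q t)"
        by (rule fq_int)
      fix t assume t: "t \<in> space circle"
      show "indicator {-m..m} t *\<^sub>R \<bar>f t\<bar> - \<bar>f t\<bar> * indicator E t \<le> f t * q t"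
      proof (cases "\<bar>t\<bar> \<le> m")
        case True
        then have "t \<in> {-m..m}" "t \<notin> E"
          by (auto simp: E_def)
        moreover have "f t * q t = \<bar>f t\<bar>"
          using q_center[OF True] by (simp add: sgn_if)
        ultimately show ?thesis
          by simp
      next
        case False
        have "\<bar>f t * q t\<bar> \<le> \<bar>f t\<bar>"
          using q_le by (simp add: abs_mult mult_left_le)
        then have "- \<bar>f t\<bar> \<le> f t * q t"
          by linarith
        moreover have "t \<notin> {-m..m}"
          using False by auto
        ultimately show ?thesis
          using False t by (cases "q t = 0") (auto simp: E_def space_circle)
      qed
    qed
    finally show ?thesis .
  qed
  ultimately have key: "(LINT t:{-m..m}|circle. \<bar>f t\<bar>) - 8 * m * C / d \<le> (LINT t|circle. f t * q t)"
    by simp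
  show thesis
  proof
    show "q (- (t + 2 * pi)) = q (- t)" for t
      using q_per[of "- t - 2 * pi"] by simp
    show "(\<lambda>t. q (- t)) \<in> borel_measurable lebesgue"
      using lebesgue_measurable_reflect[OF q_meas, of 0] by simp
    show "\<bar>q (- t)\<bar> \<le> 1" for t
      by (rule q_le)
    have "(\<integral>\<^sup>+t. indicator {t. q (- t) \<noteq> 0} t \<partial>circle) \<le> (\<integral>\<^sup>+t. (\<Sum>k\<le>N. indicator (S k \<inter> {-pi..pi}) t) \<partial>circle)"
    proof (rule nn_integral_mono)
      fix t assume t: "t \<in> space circle"
      show "(indicator {t. q (- t) \<noteq> 0} t :: ennreal) \<le> (\<Sum>k\<le>N. indicator (S k \<inter> {-pi..pi}) t)"
      proof (cases "q (- t) = 0")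
        case False
        then obtain k where k: "k \<le> N" "t \<in> S k \<inter> {-pi..pi}"
          using q_support[of "- t"] t by (auto simp: space_circle S_def)
        have "(indicator {t. q (- t) \<noteq> 0} t :: ennreal) = indicator (S k \<inter> {-pi..pi}) t"
          using False k by simp
        also have "\<dots> \<le> (\<Sum>k\<le>N. indicator (S k \<inter> {-pi..pi}) t)"
          using k by (intro member_le_sum) auto
        finally show ?thesis .
      qed simp
    qed
    also have "\<dots> = (\<Sum>k\<le>N. emeasure circle (S k \<inter> {-pi..pi}))"
      using S_circle(1) by (subst nn_integral_sum) auto
    also have "\<dots> \<le> (\<Sum>k\<le>N. ennreal (4 * m))"
      using S_circle(2) by (intro sum_mono) auto
    also have "\<dots> = ennreal (real (N + 1) * (4 * m))"
      using m by (simp add: ennreal_mult ennreal_of_nat_eq_real_of_nat del: of_nat_Suc)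
    also have "\<dots> \<le> ennreal (8 * m * real N)"
    proof (rule ennreal_leI)
      have "real (N + 1) * (4 * m) \<le> (2 * real N) * (4 * m)"
        using N m by (intro mult_right_mono) auto
      then show "real (N + 1) * (4 * m) \<le> 8 * m * real N"
        by (simp add: mult_ac)
    qed
    finally show "(\<integral>\<^sup>+t. indicator {t. q (- t) \<noteq> 0} t \<partial>circle) \<le> ennreal (8 * m * real N)" .
    show "(LINT t:{-m..m}|circle. \<bar>f t\<bar>) - 8 * m * C / d \<le> Phi f (of_int j * d) (\<lambda>t. q (- t))" for j
    proof -
      have "Phi f (of_int j * d) (\<lambda>t. q (- t)) = (LINT t|circle. f (of_int j * d - t) * q (of_int j * d - t))"
        unfolding Phi_def using q_shift[of "- t" j for t] by (simp add: add.commute)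
      also have "\<dots> = (LINT t|circle. f t * q t)"
        by (rule integral_circle_reflect[of "\<lambda>t. f t * q t"])
          (auto simp: q_per in_L_inf_periodic[OF f] fq_int)
      finally show ?thesis using key by simp
    qed
  qed
qed

section \<open>Bounded functions that are small in norm but resonate near every point\<close>

text \<open>
  The product \<open>\<bar>x\<bar> \<phi>\<^sup>*(x)\<close> is the area of a rectangle below the graph of the decreasing function
  \<open>\<phi>\<^sup>*\<close> on \<open>[0, \<bar>x\<bar>]\<close>.
\<close>

lemma phi_lower_le:
  assumes "(\<integral>\<^sup>+x. majorant f x \<partial>circle) \<le> ennreal C" "0 \<le> C"
  shows "phi_lower f \<le> C"
  unfolding phi_lower_def
proof (rule enn2real_leI[OF assms(2)], rule SUP_least)
  fix x assume "x \<in> {-pi..pi}"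
  have "ennreal \<bar>x\<bar> * majorant f x = (\<integral>\<^sup>+t. majorant f x * indicator {0..\<bar>x\<bar>} t \<partial>lebesgue)"
    by (subst nn_integral_cmult_indicator) (auto simp: mult.commute)
  also have "\<dots> \<le> (\<integral>\<^sup>+t. majorant f t * indicator {-pi..pi} t \<partial>lebesgue)"
    using \<open>x \<in> {-pi..pi}\<close> by (intro nn_integral_mono) (auto simp: indicator_def intro!: majorant_antimono)
  also have "\<dots> \<le> ennreal C"
    using assms(1) by (simp add: nn_integral_circle)
  finally show "ennreal \<bar>x\<bar> * majorant f x \<le> ennreal C" .
qed

lemma phi_lower_nonneg: "0 \<le> phi_lower f"
  by (simp add: phi_lower_def)

lemma nn_integral_supported_le:
  fixes g :: "real \<Rightarrow> real"
  assumes "\<And>t. \<bar>g t\<bar> \<le> 1" "0 \<le> h" "0 < q"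
    and "g \<in> borel_measurable M" "(\<integral>\<^sup>+t. indicator {t. g t \<noteq> 0} t \<partial>M) \<le> ennreal v" "h powr q * v \<le> e"
  shows "(\<integral>\<^sup>+t. ennreal (\<bar>h * g t\<bar> powr q) \<partial>M) \<le> ennreal e"
proof -
  have "(\<integral>\<^sup>+t. ennreal (\<bar>h * g t\<bar> powr q) \<partial>M) \<le> (\<integral>\<^sup>+t. ennreal (h powr q) * indicator {t. g t \<noteq> 0} t \<partial>M)"
  proof (rule nn_integral_mono)
    fix t
    have "\<bar>h * g t\<bar> powr q \<le> h powr q"
      using assms(1-3) by (intro powr_mono2) (auto simp: abs_mult mult_left_le)
    then show "ennreal (\<bar>h * g t\<bar> powr q) \<le> ennreal (h powr q) * indicator {t. g t \<noteq> 0} t"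
      by (auto simp: indicator_def intro!: ennreal_leI)
  qed
  also have "\<dots> = ennreal (h powr q) * (\<integral>\<^sup>+t. indicator {t. g t \<noteq> 0} t \<partial>M)"
  proof (rule nn_integral_cmult)
    have "{t \<in> space M. g t \<noteq> 0} \<in> sets M"
      using assms(4) by measurable
    then show "indicator {t. g t \<noteq> 0} \<in> borel_measurable M"
      by (simp add: borel_measurable_indicator_iff Int_def conj_commute)
  qed
  also have "\<dots> \<le> ennreal (h powr q) * ennreal v"
    using assms(5) by (rule mult_left_mono) simp
  also have "\<dots> = ennreal (h powr q * v)"
    by (rule ennreal_mult'[symmetric]) simp
  also have "\<dots> \<le> ennreal e"
    using assms(6) by (rule ennreal_leI)
  finally show ?thesis .
qed

lemma frequently_of_Limsup_infinity:
  fixes X :: "'a \<Rightarrow> real"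
  assumes "Limsup F (\<lambda>r. ereal (X r)) = \<infinity>"
  shows "\<exists>\<^sub>F r in F. A < X r"
proof (rule ccontr)
  assume "\<not> ?thesis"
  then have "\<forall>\<^sub>F r in F. ereal (X r) \<le> ereal A"
    by (simp add: not_frequently not_less)
  then have "Limsup F (\<lambda>r. ereal (X r)) \<le> ereal A"
    by (rule Limsup_bounded)
  then show False
    using assms by simp
qed

text \<open>
  A scaled comb for a kernel with \<open>\<lambda>(r) \<parallel>\<phi>\<^sub>r\<parallel>\<^sub>\<infinity> \<phi>\<^sub>*(r)\<^sup>p\<^sup>-\<^sup>1 > A\<close>. The height needed for the value \<open>B\<close> is
  inversely proportional to \<open>\<phi>\<^sub>*(r)\<close>, and the measure of the support is at most a constant times \<open>\<phi>\<^sub>*(r)\<^sup>p / A\<close>, so the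
  powers of \<open>\<phi>\<^sub>*(r)\<close> cancel in the \<open>L\<^sup>p\<close> norm and \<open>A\<close> alone makes it small. For the
  \<open>L\<^sup>1\<close> norm a factor \<open>\<phi>\<^sub>*(r)\<^sup>p\<^sup>-\<^sup>1\<close> is left, which is bounded since \<open>p > 1\<close>.
\<close>

lemma exists_resonating_bump:
  fixes \<phi> :: "real \<Rightarrow> real \<Rightarrow> real" and l :: "real \<Rightarrow> real"
  assumes L_inf: "\<And>r. r \<in> {0<..<1} \<Longrightarrow> in_L_inf (\<phi> r)"
    and C: "0 < C" "\<And>r. r \<in> {0<..<1} \<Longrightarrow> (\<integral>\<^sup>+x. majorant (\<phi> r) x \<partial>circle) \<le> ennreal C"
    and c_pos: "c_const \<phi> > 0"
    and p: "1 < p"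
    and l_pos: "\<And>r. r \<in> {0<..<1} \<Longrightarrow> l r > 0"
    and l_lim: "(l \<longlongrightarrow> 0) (at_left 1)"
    and Pi: "Pi_const p l \<phi> = \<infinity>"
    and B: "0 < B" and e: "0 < e" and \<delta>: "\<delta> < 1"
  obtains r g H where "r \<in> {0<..<1}" "\<delta> < r"
    "\<And>t. g (t + 2 * pi) = g t" "g \<in> borel_measurable lebesgue" "\<And>t. \<bar>g t\<bar> \<le> H"
    "(\<integral>\<^sup>+t. ennreal \<bar>g t\<bar> \<partial>circle) \<le> ennreal e"
    "(\<integral>\<^sup>+t. ennreal (\<bar>g t\<bar> powr p) \<partial>circle) \<le> ennreal e"
    "\<And>x. \<exists>y\<in>arc_nbhd (l r) x. B \<le> Phi (\<phi> r) y g"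
proof -
  define s where "s r = phi_lower (\<phi> r)" for r
  define M where "M r = enn2real (norm_inf (\<phi> r))" for r
  define I where "I r = (LINT t:{- mu (\<phi> r)..mu (\<phi> r)}|circle. \<bar>\<phi> r t\<bar>)" for r
  obtain c where "0 < ereal c" "ereal c < c_const \<phi>"
    using c_pos ereal_dense2 by blast
  then have c: "0 < c" and ev_c: "\<forall>\<^sub>F r in at_left 1. c < 1 / s r * I r"
    unfolding c_const_def s_def I_def by (auto dest: less_LiminfD)
  \<comment> \<open>the thresholds for \<open>A\<close>: \<open>A1\<close> separates the teeth, \<open>A2\<close> keeps the loss from the other teeth at most
      half of the central contribution, \<open>A3\<close> and \<open>A4\<close> control the \<open>L\<^sup>1\<close> and \<open>L\<^sup>p\<close> norms\<close>
  define A1 where "A1 = 4 * C powr p"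
  define A2 where "A2 = 32 * C powr p / c"
  define A3 where "A3 = 2 * B / c * (32 * pi * C powr (p - 1)) / e"
  define A4 where "A4 = (2 * B / c) powr p * (32 * pi) / e"
  define A where "A = A1 + A2 + A3 + A4 + 1"
  have A_parts: "0 \<le> A1" "0 \<le> A2" "0 \<le> A3" "0 \<le> A4"
    using C c B e by (simp_all add: A1_def A2_def A3_def A4_def)
  then have A: "A1 \<le> A" "A2 \<le> A" "A3 \<le> A" "A4 \<le> A" "0 < A"
    by (simp_all add: A_def)
  have "\<exists>\<^sub>F r in at_left 1. A < l r * M r * s r powr (p - 1)"
    using Pi unfolding Pi_const_def M_def s_def by (rule frequently_of_Limsup_infinity)
  moreover have "\<forall>\<^sub>F r in at_left 1. l r < 2 * pi"
    using l_lim by (rule order_tendstoD) simp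
  moreover have "\<forall>\<^sub>F r in at_left 1. r \<in> {max 0 \<delta><..<1}"
    using \<delta> by (intro eventually_at_leftI[of "max 0 \<delta>"]) auto
  ultimately have "\<exists>\<^sub>F r in at_left 1. ((c < 1 / s r * I r \<and> l r < 2 * pi) \<and> r \<in> {max 0 \<delta><..<1}) \<and> A < l r * M r * s r powr (p - 1)"
    by (intro frequently_eventually_conj eventually_conj ev_c)
  then obtain r where r: "A < l r * M r * s r powr (p - 1)" "c < 1 / s r * I r" "l r < 2 * pi" "r \<in> {max 0 \<delta><..<1}"
    by (auto dest!: frequently_ex)
  then have r01: "r \<in> {0<..<1}" "\<delta> < r"
    by auto
  have l: "0 < l r"
    using l_pos r01 by simp
  \<comment> \<open>\<open>s r = 0\<close> would, by the convention for division by zero, make the quotient in \<open>c_const\<close> vanish, hence not exceed \<open>c\<close>\<close>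
  have "0 \<le> s r" "s r \<le> C"
    using phi_lower_le[OF C(2)] C(1) r01 by (auto simp: s_def phi_lower_nonneg)
  moreover have "s r \<noteq> 0"
    using r(2) c by auto
  ultimately have s: "0 < s r" "s r \<le> C"
    by auto
  have I: "c * s r < I r"
    using r(2) s by (simp add: field_simps)
  have "0 \<le> M r" "M r \<noteq> 0"
    using r(1) A by (auto simp: M_def)
  then have M: "0 < M r"
    by simp
  define m where "m = s r / M r"
  have m_mu: "m = mu (\<phi> r)"
    by (simp add: m_def mu_def s_def M_def)
  have m: "0 < m"
    using s M by (simp add: m_def)
  have m_le: "m \<le> l r * (s r powr p / A)"
  proof -
    have "A * m \<le> l r * M r * s r powr (p - 1) * m"
      using r(1) m by simp
    also have "\<dots> = l r * s r powr p"
      using M s by (simp add: m_def powr_mult_base[symmetric] powr_diff)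
    finally show ?thesis
      using A by (simp add: field_simps)
  qed
  have sp: "s r powr p \<le> C powr p" "s r powr (p - 1) \<le> C powr (p - 1)"
    using s p by (auto intro!: powr_mono2)
  have sp_split: "s r powr p = s r * s r powr (p - 1)" "C powr p = C * C powr (p - 1)"
    using s C by (simp_all add: powr_diff)
  \<comment> \<open>the number of teeth: the spacing \<open>d\<close> has to divide \<open>2\<pi>\<close> and to lie between \<open>l r / 2\<close> and \<open>l r\<close>\<close>
  define N where "N = nat \<lceil>2 * pi / l r\<rceil>"
  define d where "d = 2 * pi / real N"
  have quot: "1 \<le> 2 * pi / l r"
    using r(3) l by simp
  have N: "2 * pi / l r \<le> real N" "real N \<le> 4 * pi / l r"
  proof -
    have "2 * pi / l r \<le> of_int \<lceil>2 * pi / l r\<rceil>" "of_int \<lceil>2 * pi / l r\<rceil> \<le> 2 * pi / l r + 1"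
      by linarith+
    moreover have "real N = of_int \<lceil>2 * pi / l r\<rceil>"
      using quot unfolding N_def by simp
    moreover have "4 * pi / l r = 2 * pi / l r + 2 * pi / l r"
      by simp
    ultimately show "2 * pi / l r \<le> real N" "real N \<le> 4 * pi / l r"
      using quot by linarith+
  qed
  have "1 \<le> real N"
    using N(1) quot by linarith
  then have N1: "N \<ge> 1"
    by simp
  have d: "0 < d" "d \<le> l r" "l r / 2 \<le> d"
    using N N1 l by (simp_all add: d_def field_simps)
  have m_half: "m < d / 2"
  proof -
    have "4 * s r powr p < A"
      using sp(1) A_parts by (simp add: A_def A1_def)
    then have "s r powr p / A < 1 / 4"
      using A by (simp add: field_simps)
    then have "l r * (s r powr p / A) < l r * (1 / 4)"
      using l by (rule mult_strict_left_mono)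
    then show ?thesis
      using m_le d(3) by linarith
  qed
  obtain g where g: "\<And>t. g (t + 2 * pi) = g t" "g \<in> borel_measurable lebesgue" "\<And>t. \<bar>g t\<bar> \<le> 1"
      "(\<integral>\<^sup>+t. indicator {t. g t \<noteq> 0} t \<partial>circle) \<le> ennreal (8 * m * real N)"
      "\<And>j. Phi (\<phi> r) (of_int j * d) g \<ge> (LINT t:{-m..m}|circle. \<bar>\<phi> r t\<bar>) - 8 * m * C / d"
    using comb_function[OF L_inf[OF r01(1)] _ C(2)[OF r01(1)] N1 d_def _ m_half] C(1) m by (metis less_imp_le)
  have supp_le: "8 * m * real N \<le> 32 * pi * (s r powr p / A)"
  proof -
    have "m * real N \<le> (l r * (s r powr p / A)) * (4 * pi / l r)"
      using m_le N(2) m by (intro mult_mono) auto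
    also have "\<dots> = 4 * pi * (s r powr p / A)"
      using l by simp
    finally show ?thesis
      by linarith
  qed
  have Phi_g: "c * s r / 2 \<le> Phi (\<phi> r) (of_int j * d) g" for j
  proof -
    have "8 * m * C / d \<le> 8 * (l r * (s r powr p / A)) * C / (l r / 2)"
      using m_le C(1) A(5) d l m by (intro frac_le mult_right_mono) auto
    also have "\<dots> = s r * (16 * C * s r powr (p - 1) / A)"
      using l by (simp add: sp_split)
    also have "\<dots> \<le> s r * (c / 2)"
    proof (rule mult_left_mono)
      have "16 * C * s r powr (p - 1) \<le> 16 * C powr p"
        using sp(2) C by (simp add: sp_split)
      also have "\<dots> \<le> c / 2 * A"
      proof -
        have "32 * C powr p / c \<le> A"
          using A(2) by (simp add: A2_def)
        then show ?thesis
          using c by (simp add: field_simps)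
      qed
      finally show "16 * C * s r powr (p - 1) / A \<le> c / 2"
        using A by (simp add: pos_divide_le_eq)
    qed (use s in simp)
    finally have "8 * m * C / d \<le> c * s r / 2"
      by (simp add: mult.commute)
    moreover have "I r = (LINT t:{-m..m}|circle. \<bar>\<phi> r t\<bar>)"
      by (simp add: I_def m_mu)
    ultimately show ?thesis
      using g(5)[of j] I by linarith
  qed
  define h where "h = 2 * B / (c * s r)"
  have h: "0 < h"
    using B c s by (simp add: h_def)
  have g_circle: "g \<in> borel_measurable circle"
    using g(2) by (rule circle_measurable)
  show thesis
  proof
    show "r \<in> {0<..<1}" "\<delta> < r"
      by (fact r01)+
    show "h * g (t + 2 * pi) = h * g t" for t
      by (simp add: g(1))
    show "(\<lambda>t. h * g t) \<in> borel_measurable lebesgue"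
      using g(2) by simp
    show "\<bar>h * g t\<bar> \<le> h" for t
      using h g(3) by (simp add: abs_mult mult_left_le)
    have "(\<integral>\<^sup>+t. ennreal (\<bar>h * g t\<bar> powr 1) \<partial>circle) \<le> ennreal e"
    proof (rule nn_integral_supported_le[OF g(3) _ _ g_circle g(4)])
      have "h powr 1 * (8 * m * real N) \<le> h * (32 * pi * (s r powr p / A))"
        using mult_left_mono[OF supp_le, of h] h by simp
      also have "\<dots> = 2 * B / c * (32 * pi * s r powr (p - 1)) / A"
        using s c by (simp add: h_def sp_split)
      also have "\<dots> \<le> 2 * B / c * (32 * pi * C powr (p - 1)) / A"
        using sp B c A by (intro divide_right_mono mult_left_mono) auto
      also have "\<dots> \<le> e"
      proof -
        have "2 * B / c * (32 * pi * C powr (p - 1)) / e \<le> A"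
          using A(3) by (simp add: A3_def)
        then show ?thesis
          using A(5) e by (simp only: pos_divide_le_eq mult.commute)
      qed
      finally show "h powr 1 * (8 * m * real N) \<le> e" .
    qed (use h in auto)
    then show "(\<integral>\<^sup>+t. ennreal \<bar>h * g t\<bar> \<partial>circle) \<le> ennreal e"
      by simp
    show "(\<integral>\<^sup>+t. ennreal (\<bar>h * g t\<bar> powr p) \<partial>circle) \<le> ennreal e"
    proof (rule nn_integral_supported_le[OF g(3) _ _ g_circle g(4)])
      have "h powr p * (8 * m * real N) \<le> h powr p * (32 * pi * (s r powr p / A))"
        by (rule mult_left_mono[OF supp_le]) simp
      also have "\<dots> = (h * s r) powr p * (32 * pi) / A"
        using s h by (simp add: powr_mult)
      also have "h * s r = 2 * B / c"
        using s by (simp add: h_def)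
      also have "(2 * B / c) powr p * (32 * pi) / A \<le> e"
      proof -
        have "(2 * B / c) powr p * (32 * pi) / e \<le> A"
          using A(4) by (simp add: A4_def)
        then show ?thesis
          using A(5) e by (simp only: pos_divide_le_eq mult.commute)
      qed
      finally show "h powr p * (8 * m * real N) \<le> e" .
    qed (use h p in auto)
    show "\<exists>y\<in>arc_nbhd (l r) x. B \<le> Phi (\<phi> r) y (\<lambda>t. h * g t)" for x
    proof
      let ?y = "of_int (round (x / d)) * d"
      have "Phi (\<phi> r) ?y (\<lambda>t. h * g t) = h * Phi (\<phi> r) ?y g"
        unfolding Phi_def by (simp add: mult.left_commute)
      moreover have "h * (c * s r / 2) \<le> h * Phi (\<phi> r) ?y g"
        using Phi_g h by (simp add: mult_left_mono)
      moreover have "h * (c * s r / 2) = B"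
        using c s by (simp add: h_def)
      ultimately show "B \<le> Phi (\<phi> r) ?y (\<lambda>t. h * g t)"
        by simp
      have "\<bar>of_int (round (x / d)) - x / d\<bar> * d \<le> 1 / 2 * d"
        using d(1) of_int_round_abs_le[of "x / d"] by (intro mult_right_mono) auto
      moreover have "?y - x = (of_int (round (x / d)) - x / d) * d"
        using d(1) by (simp add: left_diff_distrib)
      ultimately have "\<bar>?y - x\<bar> \<le> d / 2"
        using d(1) by (simp add: abs_mult)
      then have "x - l r \<le> ?y" "?y \<le> x + l r"
        using d(1,2) by linarith+
      then show "?y \<in> arc_nbhd (l r) x"
        by (simp add: arc_nbhd_def)
    qed
  qed
qed

section \<open>The gliding hump\<close>

text \<open>
  Weighting the terms by \<open>2\<^sup>i\<^sup>+\<^sup>1\<close> replaces the triangle inequality for infinitely many summands: wherever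
  \<open>G = \<Sum>\<^sub>i (2\<^sup>i\<^sup>+\<^sup>1 \<bar>u\<^sub>i\<bar>)\<^sup>p\<close> is finite, each \<open>\<bar>u\<^sub>i\<bar>\<close> is at most \<open>2\<^sup>-\<^sup>(\<^sup>i\<^sup>+\<^sup>1\<^sup>) G\<^sup>1\<^sup>/\<^sup>p\<close>, so the series converges
  absolutely with \<open>\<bar>\<Sum>\<^sub>i u\<^sub>i\<bar>\<^sup>p \<le> G\<close>, and \<open>G\<close> has integral at most \<open>1\<close>.
\<close>

lemma Lp_series:
  fixes u :: "nat \<Rightarrow> 'a \<Rightarrow> real"
  assumes p: "0 < p" and u [measurable]: "\<And>i. u i \<in> borel_measurable M"
    and small: "\<And>i. (\<integral>\<^sup>+t. ennreal (\<bar>u i t\<bar> powr p) \<partial>M) \<le> ennreal (2 powr (- (p + 1) * real (Suc i)))"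
  shows "AE t in M. summable (\<lambda>i. \<bar>u i t\<bar>)"
    and "integrable M (\<lambda>t. \<bar>\<Sum>i. u i t\<bar> powr p)"
proof -
  define w where "w i t = (2 ^ Suc i * \<bar>u i t\<bar>) powr p" for i t
  define G where "G t = (\<Sum>i. ennreal (w i t))" for t
  have [measurable]: "w i \<in> borel_measurable M" for i
    unfolding w_def by measurable
  have [measurable]: "G \<in> borel_measurable M"
    unfolding G_def by measurable
  have "(\<integral>\<^sup>+t. G t \<partial>M) = (\<Sum>i. \<integral>\<^sup>+t. ennreal (w i t) \<partial>M)"
    unfolding G_def by (rule nn_integral_suminf) simp
  also have "\<dots> \<le> (\<Sum>i. ennreal ((1 / 2) ^ Suc i))"
  proof (rule suminf_le)
    fix i
    have "(\<integral>\<^sup>+t. ennreal (w i t) \<partial>M) = ennreal (2 powr (p * real (Suc i))) * (\<integral>\<^sup>+t. ennreal (\<bar>u i t\<bar> powr p) \<partial>M)"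
    proof (subst nn_integral_cmult[symmetric])
      have "w i t = 2 powr (p * real (Suc i)) * \<bar>u i t\<bar> powr p" for t
        by (simp add: w_def powr_mult powr_powr mult.commute flip: powr_realpow del: power_Suc of_nat_Suc)
      then show "(\<integral>\<^sup>+t. ennreal (w i t) \<partial>M) = (\<integral>\<^sup>+t. ennreal (2 powr (p * real (Suc i))) * ennreal (\<bar>u i t\<bar> powr p) \<partial>M)"
        by (simp add: ennreal_mult)
    qed simp
    also have "\<dots> \<le> ennreal (2 powr (p * real (Suc i))) * ennreal (2 powr (- (p + 1) * real (Suc i)))"
      using small[of i] by (rule mult_left_mono) simp
    also have "\<dots> = ennreal (2 powr (p * real (Suc i) + - (p + 1) * real (Suc i)))"
      by (simp only: powr_add ennreal_mult powr_ge_zero)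
    also have "p * real (Suc i) + - (p + 1) * real (Suc i) = - real (Suc i)"
      by (simp add: algebra_simps)
    also have "2 powr (- real (Suc i)) = (1 / 2 :: real) ^ Suc i"
      by (simp only: powr_minus powr_realpow zero_less_numeral power_one_over inverse_eq_divide)
    finally show "(\<integral>\<^sup>+t. ennreal (w i t) \<partial>M) \<le> ennreal ((1 / 2) ^ Suc i)" .
  qed auto
  also have "\<dots> = ennreal 1"
    by (rule suminf_ennreal_eq[OF _ power_half_series]) simp
  finally have G_fin: "(\<integral>\<^sup>+t. G t \<partial>M) \<le> ennreal 1" .
  then have AE_G: "AE t in M. G t \<noteq> \<infinity>"
    by (intro nn_integral_PInf_AE) (auto simp: top_unique)
  have pointwise: "summable (\<lambda>i. \<bar>u i t\<bar>)" "ennreal (\<bar>\<Sum>i. u i t\<bar> powr p) \<le> G t" if "G t \<noteq> \<infinity>" for t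
  proof -
    have "\<exists>x\<ge>0. G t = ennreal x"
      using that by (cases "G t") auto
    then obtain x where x: "0 \<le> x" "G t = ennreal x"
      by blast
    have u_le: "\<bar>u i t\<bar> \<le> x powr (1 / p) * (1 / 2) ^ Suc i" for i
    proof -
      have "ennreal (w i t) \<le> G t"
        unfolding G_def using sum_le_suminf[of "\<lambda>i. ennreal (w i t)" "{i}"] by simp
      then have "w i t \<le> x"
        using x by (simp add: ennreal_le_iff)
      then have "w i t powr (1 / p) \<le> x powr (1 / p)"
        using p by (intro powr_mono2) (auto simp: w_def)
      moreover have "w i t powr (1 / p) = 2 ^ Suc i * \<bar>u i t\<bar>"
        using p by (simp add: w_def powr_powr del: power_Suc)
      ultimately show ?thesis
        by (simp add: field_simps)
    qed
    have geo: "(\<lambda>i. x powr (1 / p) * (1 / 2) ^ Suc i) sums (x powr (1 / p))"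
      using sums_mult[OF power_half_series, of "x powr (1 / p)"] by simp
    show sum: "summable (\<lambda>i. \<bar>u i t\<bar>)"
      by (rule summable_comparison_test'[OF sums_summable[OF geo], of 0]) (use u_le in simp)
    have "\<bar>\<Sum>i. u i t\<bar> \<le> (\<Sum>i. \<bar>u i t\<bar>)"
      using sum by (rule summable_rabs)
    also have "\<dots> \<le> x powr (1 / p)"
      using suminf_le[OF u_le sum sums_summable[OF geo]] sums_unique[OF geo] by simp
    finally have "\<bar>\<Sum>i. u i t\<bar> powr p \<le> (x powr (1 / p)) powr p"
      using p by (intro powr_mono2) auto
    also have "\<dots> = x"
      using p x by (simp add: powr_powr)
    finally show "ennreal (\<bar>\<Sum>i. u i t\<bar> powr p) \<le> G t"
      using x by (simp add: ennreal_le_iff)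
  qed
  show "AE t in M. summable (\<lambda>i. \<bar>u i t\<bar>)"
    using AE_G by eventually_elim (rule pointwise)
  show "integrable M (\<lambda>t. \<bar>\<Sum>i. u i t\<bar> powr p)"
  proof (rule integrableI_bounded)
    have "(\<integral>\<^sup>+t. ennreal (norm (\<bar>\<Sum>i. u i t\<bar> powr p)) \<partial>M) \<le> (\<integral>\<^sup>+t. G t \<partial>M)"
    proof (rule nn_integral_mono_AE)
      show "AE t in M. ennreal (norm (\<bar>\<Sum>i. u i t\<bar> powr p)) \<le> G t"
        using AE_G by eventually_elim (use pointwise in simp)
    qed
    also have "\<dots> < \<infinity>"
      using G_fin by (simp add: le_less_trans)
    finally show "(\<integral>\<^sup>+t. ennreal (norm (\<bar>\<Sum>i. u i t\<bar> powr p)) \<partial>M) < \<infinity>" .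
  qed measurable
qed

lemma AE_le_norm_inf:
  assumes "in_L_inf f"
  shows "AE t in circle. \<bar>f t\<bar> \<le> enn2real (norm_inf f)"
proof -
  have "norm_inf f < \<infinity>"
    using assms by (simp add: in_L_inf_def)
  moreover have "AE t in circle. ennreal \<bar>f t\<bar> \<le> norm_inf f"
    unfolding norm_inf_def by (rule esssup_AE)
  ultimately show ?thesis
    by (auto elim!: eventually_mono simp: enn2real_le_iff le_ennreal_iff) (metis enn2real_ennreal enn2real_mono abs_ge_zero)
qed

text \<open>
  The two Hoelder bounds for a convolution. The first controls at a new kernel the humps constructed
  before it, the second controls at an old kernel the humps constructed after it. For the second, the essential bound on \<open>f\<close> is
  used after a reflection, when the argument of \<open>f\<close> is the variable of integration.
\<close>

lemma convolution_bounds: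
  fixes f g :: "real \<Rightarrow> real"
  assumes f: "in_L_inf f" and g: "\<And>t. g (t + 2 * pi) = g t" "g \<in> borel_measurable lebesgue"
  shows "(\<And>t. \<bar>g t\<bar> \<le> H) \<Longrightarrow> (\<integral>\<^sup>+t. ennreal \<bar>f (y - t) * g t\<bar> \<partial>circle) \<le> ennreal H * (\<integral>\<^sup>+t. ennreal \<bar>f t\<bar> \<partial>circle)"
    and "(\<integral>\<^sup>+t. ennreal \<bar>f (y - t) * g t\<bar> \<partial>circle) \<le> ennreal (enn2real (norm_inf f)) * (\<integral>\<^sup>+t. ennreal \<bar>g t\<bar> \<partial>circle)"
proof -
  have [measurable]: "f \<in> borel_measurable lebesgue" "g \<in> borel_measurable lebesgue"
    using f g by (auto intro: in_L_inf_lebesgue_measurable)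
  have f_per: "f (t + 2 * pi) = f t" for t
    by (rule in_L_inf_periodic[OF f])
  have reflect: "(\<integral>\<^sup>+t. ennreal \<bar>k (y - t)\<bar> \<partial>circle) = (\<integral>\<^sup>+t. ennreal \<bar>k t\<bar> \<partial>circle)"
    if "\<And>t. k (t + 2 * pi) = k t" "k \<in> borel_measurable lebesgue" for k :: "real \<Rightarrow> real"
    using that by (intro nn_integral_circle_reflect[of "\<lambda>t. ennreal \<bar>k t\<bar>"]) simp_all
  have meas: "(\<lambda>t. ennreal \<bar>k (y - t)\<bar>) \<in> borel_measurable circle" if "k \<in> borel_measurable lebesgue" for k :: "real \<Rightarrow> real"
    using circle_measurable[OF lebesgue_measurable_reflect[OF that, of y]] by measurable
  {
    assume H: "\<And>t. \<bar>g t\<bar> \<le> H"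
    have "(\<integral>\<^sup>+t. ennreal \<bar>f (y - t) * g t\<bar> \<partial>circle) \<le> (\<integral>\<^sup>+t. ennreal H * ennreal \<bar>f (y - t)\<bar> \<partial>circle)"
    proof (rule nn_integral_mono)
      fix t
      have "\<bar>f (y - t) * g t\<bar> \<le> H * \<bar>f (y - t)\<bar>"
        using H[of t] by (simp add: abs_mult mult.commute mult_right_mono)
      then show "ennreal \<bar>f (y - t) * g t\<bar> \<le> ennreal H * ennreal \<bar>f (y - t)\<bar>"
        by (simp add: ennreal_leI flip: ennreal_mult'')
    qed
    also have "\<dots> = ennreal H * (\<integral>\<^sup>+t. ennreal \<bar>f t\<bar> \<partial>circle)"
      using reflect[of f] f_per meas[of f] by (simp add: nn_integral_cmult)
    finally show "(\<integral>\<^sup>+t. ennreal \<bar>f (y - t) * g t\<bar> \<partial>circle) \<le> ennreal H * (\<integral>\<^sup>+t. ennreal \<bar>f t\<bar> \<partial>circle)" .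
  }
  let ?M = "enn2real (norm_inf f)"
  let ?k = "\<lambda>t. f t * g (y - t)"
  have k_meas: "?k \<in> borel_measurable lebesgue"
    using lebesgue_measurable_reflect[OF g(2), of y] by measurable
  have k_per: "?k (t + 2 * pi) = ?k t" for t
  proof -
    have "g (y - (t + 2 * pi)) = g (y - t)"
      using g(1)[of "y - (t + 2 * pi)"] by (simp add: algebra_simps)
    then show ?thesis using f_per by simp
  qed
  have "(\<integral>\<^sup>+t. ennreal \<bar>f (y - t) * g t\<bar> \<partial>circle) = (\<integral>\<^sup>+t. ennreal \<bar>?k (y - t)\<bar> \<partial>circle)"
    by simp
  also have "\<dots> = (\<integral>\<^sup>+t. ennreal \<bar>?k t\<bar> \<partial>circle)"
    by (rule reflect[of ?k, OF k_per k_meas])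
  also have "\<dots> \<le> (\<integral>\<^sup>+t. ennreal ?M * ennreal \<bar>g (y - t)\<bar> \<partial>circle)"
  proof (rule nn_integral_mono_AE)
    show "AE t in circle. ennreal \<bar>?k t\<bar> \<le> ennreal ?M * ennreal \<bar>g (y - t)\<bar>"
      using AE_le_norm_inf[OF f]
    proof eventually_elim
      case (elim t)
      then have "\<bar>?k t\<bar> \<le> ?M * \<bar>g (y - t)\<bar>"
        by (simp add: abs_mult mult_right_mono)
      then show ?case
        by (simp add: ennreal_leI flip: ennreal_mult'')
    qed
  qed
  also have "\<dots> = ennreal ?M * (\<integral>\<^sup>+t. ennreal \<bar>g t\<bar> \<partial>circle)"
    using reflect[of g] meas[of g] g by (simp add: nn_integral_cmult)
  finally show "(\<integral>\<^sup>+t. ennreal \<bar>f (y - t) * g t\<bar> \<partial>circle) \<le> ennreal ?M * (\<integral>\<^sup>+t. ennreal \<bar>g t\<bar> \<partial>circle)" .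
qed

text \<open>
  One large term outweighs the earlier terms, which it was chosen to dominate, and the later ones,
  whose total is at most \<open>\<Sum>\<^sub>i 2\<^sup>-\<^sup>(\<^sup>i\<^sup>+\<^sup>1\<^sup>) = 1\<close>.
\<close>

lemma peak_suminf_ge:
  fixes x :: "nat \<Rightarrow> real"
  assumes "summable x"
    and "\<And>i. i < k \<Longrightarrow> \<bar>x i\<bar> \<le> a i" and "\<And>i. k < i \<Longrightarrow> \<bar>x i\<bar> \<le> (1 / 2) ^ Suc i"
    and "b + sum a {..<k} + 1 \<le> x k"
  shows "b \<le> suminf x"
proof -
  define e where "e i = (if i < k then - a i else b + sum a {..<k} + 1)" for i
  define c where "c i = (if i \<in> {..k} then e i else 0) - (1 / 2) ^ Suc i" for i
  have "c sums (sum e {..k} - 1)"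
    unfolding c_def by (intro sums_diff sums_If_finite_set power_half_series) simp
  moreover have "sum e {..k} - 1 = b"
    by (simp add: e_def lessThan_Suc_atMost[symmetric] sum_negf)
  moreover have "c i \<le> x i" for i
  proof -
    define z where "z = (1 / 2 :: real) ^ Suc i"
    have "0 \<le> z"
      by (simp add: z_def)
    moreover have "c i = (if i \<in> {..k} then e i else 0) - z"
      by (simp add: c_def z_def)
    ultimately show ?thesis
      using assms(2)[of i] assms(3)[of i, folded z_def] assms(4)
      by (cases i k rule: linorder_cases) (auto simp: e_def)
  qed
  ultimately show ?thesis
    using suminf_le[of c x] assms(1) by (metis sums_summable sums_unique)
qed

theorem theorem2p3:
  fixes \<phi> :: "real \<Rightarrow> real \<Rightarrow> real" and l :: "real \<Rightarrow> real" and p :: real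
  assumes "approximate_identity \<phi>"
    and "c_const \<phi> > 0"
    and "1 < p"
    and "\<And>r. r \<in> {0<..<1} \<Longrightarrow> l r > 0"
    and "(l \<longlongrightarrow> 0) (at_left 1)"
    and "Pi_const p l \<phi> = \<infinity>"
  shows "\<exists>f :: real \<Rightarrow> real. in_L p f \<and>
           (\<forall>x. Limsup (at_left 1) (\<lambda>r. SUP y\<in>arc_nbhd (l r) x. ereal (Phi (\<phi> r) y f)) = \<infinity>)"
proof -
  have L_inf: "in_L_inf (\<phi> r)" if "r \<in> {0<..<1}" for r
    using assms(1) that by (simp add: approximate_identity_def)
  obtain C where C: "0 < C" "\<And>r. r \<in> {0<..<1} \<Longrightarrow> (\<integral>\<^sup>+x. majorant (\<phi> r) x \<partial>circle) \<le> ennreal C"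
  proof
    let ?S = "SUP r\<in>{0<..<1}. \<integral>\<^sup>+x. majorant (\<phi> r) x \<partial>circle"
    have S: "?S < \<infinity>"
      using assms(1) by (simp add: approximate_identity_def)
    show "0 < enn2real ?S + 1"
      by (simp add: add_nonneg_pos)
    fix r :: real assume "r \<in> {0<..<1}"
    then have "(\<integral>\<^sup>+x. majorant (\<phi> r) x \<partial>circle) \<le> ?S"
      by (rule SUP_upper)
    also have "\<dots> = ennreal (enn2real ?S)"
      using S by (simp add: less_top)
    also have "\<dots> \<le> ennreal (enn2real ?S + 1)"
      by (rule ennreal_leI) simp
    finally show "(\<integral>\<^sup>+x. majorant (\<phi> r) x \<partial>circle) \<le> ennreal (enn2real ?S + 1)" .
  qed
  define M where "M r = enn2real (norm_inf (\<phi> r))" for r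
  have M0: "0 \<le> M r" for r
    by (simp add: M_def)
  \<comment> \<open>the smallness \<open>e\<close> and height \<open>B\<close> demanded of the \<open>k\<close>-th hump, given the earlier ones; a hump is recorded as
      its parameter \<open>r\<close>, the function, and a bound for the function. The power of \<open>2\<close> serves \<open>Lp_series\<close>, the
      denominator tames the earlier kernels, and the \<open>1\<close> in \<open>B\<close> is the budget of the later humps\<close>
  define e where "e F k = 2 powr (- (p + 1) * real (Suc k)) / (1 + (\<Sum>i<k. M (fst (F i))))"
    for F :: "nat \<Rightarrow> real \<times> (real \<Rightarrow> real) \<times> real" and k
  define B where "B F k = real k + (\<Sum>i<k. C * snd (snd (F i))) + 1"
    for F :: "nat \<Rightarrow> real \<times> (real \<Rightarrow> real) \<times> real" and k
  define P where "P F k z \<longleftrightarrow> (case z of (r, g, H) \<Rightarrow> r \<in> {0<..<1} \<and> 1 - 1 / real (Suc k) < r \<and>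
      (\<forall>t. g (t + 2 * pi) = g t) \<and> g \<in> borel_measurable lebesgue \<and> (\<forall>t. \<bar>g t\<bar> \<le> H) \<and>
      (\<integral>\<^sup>+t. ennreal \<bar>g t\<bar> \<partial>circle) \<le> ennreal (e F k) \<and>
      (\<integral>\<^sup>+t. ennreal (\<bar>g t\<bar> powr p) \<partial>circle) \<le> ennreal (e F k) \<and>
      (\<forall>x. \<exists>y\<in>arc_nbhd (l r) x. B F k \<le> Phi (\<phi> r) y g))" for F k z
  have "\<exists>F. \<forall>k. P F k (F k)"
  proof (rule dependent_wellorder_choice)
    fix F G :: "nat \<Rightarrow> real \<times> (real \<Rightarrow> real) \<times> real" and k z
    assume "\<And>i. i < k \<Longrightarrow> F i = G i"
    then have "e F k = e G k" "B F k = B G k"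
      by (simp_all add: e_def B_def)
    then show "P F k z = P G k z"
      by (simp add: P_def)
  next
    fix F :: "nat \<Rightarrow> real \<times> (real \<Rightarrow> real) \<times> real" and k
    have e0: "0 < e F k"
      using M0 by (simp add: e_def add_pos_nonneg sum_nonneg)
    \<comment> \<open>for arbitrary \<open>F\<close> the height \<open>B F k\<close> need not be positive\<close>
    have B1: "0 < max 1 (B F k)" and d1: "1 - 1 / real (Suc k) < 1"
      by auto
    show "\<exists>z. P F k z"
    proof (rule exists_resonating_bump[of \<phi> C p l "max 1 (B F k)" "e F k" "1 - 1 / real (Suc k)"])
      fix r g H
      assume "r \<in> {0<..<1}" "1 - 1 / real (Suc k) < r"
        "\<And>t. g (t + 2 * pi) = g t" "g \<in> borel_measurable lebesgue" "\<And>t. \<bar>g t\<bar> \<le> H"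
        "(\<integral>\<^sup>+t. ennreal \<bar>g t\<bar> \<partial>circle) \<le> ennreal (e F k)"
        "(\<integral>\<^sup>+t. ennreal (\<bar>g t\<bar> powr p) \<partial>circle) \<le> ennreal (e F k)"
        "\<And>x. \<exists>y\<in>arc_nbhd (l r) x. max 1 (B F k) \<le> Phi (\<phi> r) y g"
      then have "P F k (r, g, H)"
        unfolding P_def prod.case max.bounded_iff by blast
      then show "\<exists>z. P F k z" ..
    qed (fact L_inf C assms B1 e0 d1)+
  qed
  then obtain F where F: "\<And>k. P F k (F k)"
    by blast
  define r where "r k = fst (F k)" for k
  define g where "g k = fst (snd (F k))" for k
  define H where "H k = snd (snd (F k))" for k
  define \<epsilon> where "\<epsilon> k = e F k" for k
  have r: "r k \<in> {0<..<1}" "1 - 1 / real (Suc k) < r k" for k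
    using F[of k] by (auto simp: P_def r_def split: prod.splits)
  have g: "g k (t + 2 * pi) = g k t" "g k \<in> borel_measurable lebesgue" "\<bar>g k t\<bar> \<le> H k"
      "(\<integral>\<^sup>+t. ennreal \<bar>g k t\<bar> \<partial>circle) \<le> ennreal (\<epsilon> k)"
      "(\<integral>\<^sup>+t. ennreal (\<bar>g k t\<bar> powr p) \<partial>circle) \<le> ennreal (\<epsilon> k)" for k t
    using F[of k] by (auto simp: P_def g_def H_def \<epsilon>_def split: prod.splits)
  have peak: "\<exists>y\<in>arc_nbhd (l (r k)) x. real k + (\<Sum>i<k. C * H i) + 1 \<le> Phi (\<phi> (r k)) y (g k)" for k x
    using F[of k] by (auto simp: P_def g_def H_def r_def B_def split: prod.splits)
  have sumM: "0 < 1 + (\<Sum>i<k. M (r i))" for k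
    using M0 by (simp add: add_pos_nonneg sum_nonneg)
  have \<epsilon>: "\<epsilon> k = 2 powr (- (p + 1) * real (Suc k)) / (1 + (\<Sum>i<k. M (r i)))" for k
    by (simp add: \<epsilon>_def e_def r_def)
  have \<epsilon>0: "0 \<le> \<epsilon> k" for k
    unfolding \<epsilon> using sumM[of k] by simp
  have \<epsilon>_small: "\<epsilon> k \<le> 2 powr (- (p + 1) * real (Suc k))" for k
  proof -
    have "2 powr (- (p + 1) * real (Suc k)) / (1 + (\<Sum>i<k. M (r i))) \<le> 2 powr (- (p + 1) * real (Suc k)) / 1"
      using M0 sumM[of k] by (intro divide_left_mono) (auto simp: sum_nonneg)
    then show ?thesis
      by (simp add: \<epsilon>)
  qed
  have half: "2 powr (- (p + 1) * real (Suc k)) \<le> (1 / 2) ^ Suc k" for k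
  proof -
    have "2 powr (- (p + 1) * real (Suc k)) \<le> 2 powr (- real (Suc k))"
    proof (rule powr_mono)
      have "0 \<le> p * real (Suc k)"
        using assms(3) by simp
      then show "- (p + 1) * real (Suc k) \<le> - real (Suc k)"
        by (simp add: algebra_simps)
    qed simp
    also have "2 powr (- real (Suc k)) = (1 / 2 :: real) ^ Suc k"
      by (simp only: powr_minus powr_realpow zero_less_numeral power_one_over inverse_eq_divide)
    finally show ?thesis .
  qed
  have M\<epsilon>: "M (r k) * \<epsilon> i \<le> (1 / 2) ^ Suc i" if "k < i" for k i
  proof -
    have "M (r k) \<le> (\<Sum>j<i. M (r j))"
      using that M0 by (intro member_le_sum) auto
    then have "M (r k) * \<epsilon> i \<le> (1 + (\<Sum>j<i. M (r j))) * \<epsilon> i"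
      using \<epsilon>0 by (intro mult_right_mono) auto
    also have "\<dots> = 2 powr (- (p + 1) * real (Suc i))"
      using sumM[of i] by (simp add: \<epsilon>)
    also have "\<dots> \<le> (1 / 2) ^ Suc i"
      by (rule half)
    finally show ?thesis .
  qed
  have g_circle [measurable]: "g k \<in> borel_measurable circle" for k
    by (rule circle_measurable[OF g(2)])
  define f where "f t = (\<Sum>i. g i t)" for t
  have p0: "0 < p"
    using assms(3) by simp
  have Lp_small: "(\<integral>\<^sup>+t. ennreal (\<bar>g i t\<bar> powr p) \<partial>circle) \<le> ennreal (2 powr (- (p + 1) * real (Suc i)))" for i
    using g(5)[of i] ennreal_leI[OF \<epsilon>_small[of i]] by (rule order_trans)
  have AE_sum: "AE t in circle. summable (\<lambda>i. \<bar>g i t\<bar>)"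
    and Lp: "integrable circle (\<lambda>t. \<bar>f t\<bar> powr p)"
    unfolding f_def using Lp_series[of p g circle, OF p0 g_circle Lp_small] by auto
  have in_L: "in_L p f"
  proof -
    have "periodic f"
      unfolding periodic_def by unfold_locales (simp add: f_def g(1))
    moreover have "f \<in> borel_measurable circle"
      unfolding f_def by measurable
    ultimately show ?thesis
      using Lp by (simp add: in_L_def)
  qed
  have Phi_f: "real k \<le> Phi (\<phi> (r k)) y f"
    if y: "real k + (\<Sum>i<k. C * H i) + 1 \<le> Phi (\<phi> (r k)) y (g k)" for k y
  proof -
    \<comment> \<open>expand \<open>\<Phi>\<close> of the sum termwise; the \<open>k\<close>-th term is the peak\<close>
    let ?u = "\<lambda>i t. \<phi> (r k) (y - t) * g i t"
    have meas [measurable]: "?u i \<in> borel_measurable circle" for i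
      using circle_measurable[OF lebesgue_measurable_reflect[OF in_L_inf_lebesgue_measurable[OF L_inf[OF r(1)]], of k y]]
      by measurable
    have H0: "0 \<le> H i" for i
      using g(3)[of i 0] by linarith
    have early: "(\<integral>\<^sup>+t. ennreal \<bar>?u i t\<bar> \<partial>circle) \<le> ennreal (C * H i)" for i
    proof -
      have "(\<integral>\<^sup>+t. ennreal \<bar>?u i t\<bar> \<partial>circle) \<le> ennreal (H i) * (\<integral>\<^sup>+t. ennreal \<bar>\<phi> (r k) t\<bar> \<partial>circle)"
        by (rule convolution_bounds(1)[OF L_inf[OF r(1)] g(1,2,3)])
      also have "\<dots> \<le> ennreal (H i) * ennreal C"
        using order_trans[OF nn_integral_le_majorant C(2)[OF r(1)]] by (rule mult_left_mono) simp
      also have "\<dots> = ennreal (C * H i)"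
        using C(1) H0 by (simp add: mult.commute flip: ennreal_mult)
      finally show ?thesis .
    qed
    have late: "(\<integral>\<^sup>+t. ennreal \<bar>?u i t\<bar> \<partial>circle) \<le> ennreal ((1 / 2) ^ Suc i)" if "k < i" for i
    proof -
      have "(\<integral>\<^sup>+t. ennreal \<bar>?u i t\<bar> \<partial>circle) \<le> ennreal (M (r k)) * (\<integral>\<^sup>+t. ennreal \<bar>g i t\<bar> \<partial>circle)"
        unfolding M_def by (rule convolution_bounds(2)[OF L_inf[OF r(1)] g(1,2)])
      also have "\<dots> \<le> ennreal (M (r k)) * ennreal (\<epsilon> i)"
        using g(4) by (rule mult_left_mono) simp
      also have "\<dots> = ennreal (M (r k) * \<epsilon> i)"
        using M0 \<epsilon>0 by (simp add: ennreal_mult)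
      also have "\<dots> \<le> ennreal ((1 / 2) ^ Suc i)"
        by (rule ennreal_leI[OF M\<epsilon>[OF that]])
      finally show ?thesis .
    qed
    have int: "integrable circle (?u i)" for i
      using early[of i] by (intro integrableI_bounded meas) (auto intro: le_less_trans)
    have L1: "(LINT t|circle. \<bar>?u i t\<bar>) \<le> b"
      if "(\<integral>\<^sup>+t. ennreal \<bar>?u i t\<bar> \<partial>circle) \<le> ennreal b" "0 \<le> b" for i b
      using that nn_integral_eq_integral[OF integrable_abs[OF int[of i]]] by (simp add: ennreal_le_iff)
    have Phi_le: "\<bar>Phi (\<phi> (r k)) y (g i)\<bar> \<le> (LINT t|circle. \<bar>?u i t\<bar>)" for i
      unfolding Phi_def by (rule integral_abs_bound)
    have sums: "(\<lambda>i. Phi (\<phi> (r k)) y (g i)) sums (LINT t|circle. (\<Sum>i. ?u i t))"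
      unfolding Phi_def
    proof (rule sums_integral[OF int])
      show "AE t in circle. summable (\<lambda>i. norm (?u i t))"
        using AE_sum by eventually_elim (simp add: abs_mult summable_mult)
      have "summable (\<lambda>i. (1 / 2 :: real) ^ Suc i)"
        using power_half_series by (rule sums_summable)
      then show "summable (\<lambda>i. LINT t|circle. norm (?u i t))"
        by (rule summable_comparison_test'[of _ "Suc k"]) (use L1 late in \<open>auto simp del: power_Suc\<close>)
    qed
    have "(LINT t|circle. (\<Sum>i. ?u i t)) = Phi (\<phi> (r k)) y f"
      unfolding Phi_def
    proof (rule integral_cong_AE)
      show "AE t in circle. (\<Sum>i. ?u i t) = \<phi> (r k) (y - t) * f t"
        using AE_sum by eventually_elim (auto simp: f_def intro!: suminf_mult summable_rabs_cancel)
      show "(\<lambda>t. \<Sum>i. ?u i t) \<in> borel_measurable circle"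
        by measurable
      show "(\<lambda>t. \<phi> (r k) (y - t) * f t) \<in> borel_measurable circle"
        using in_L circle_measurable[OF lebesgue_measurable_reflect[OF in_L_inf_lebesgue_measurable[OF L_inf[OF r(1)]], of k y]]
        by (auto simp: in_L_def)
    qed
    then have "(\<Sum>i. Phi (\<phi> (r k)) y (g i)) = Phi (\<phi> (r k)) y f"
      using sums sums_unique by metis
    moreover have "real k \<le> (\<Sum>i. Phi (\<phi> (r k)) y (g i))"
    proof (rule peak_suminf_ge[where a = "\<lambda>i. C * H i"])
      show "summable (\<lambda>i. Phi (\<phi> (r k)) y (g i))"
        using sums by (rule sums_summable)
      show "\<bar>Phi (\<phi> (r k)) y (g i)\<bar> \<le> C * H i" if "i < k" for i
        by (rule order_trans[OF Phi_le L1[OF early]]) (use C(1) H0 in simp)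
      show "\<bar>Phi (\<phi> (r k)) y (g i)\<bar> \<le> (1 / 2) ^ Suc i" if "k < i" for i
        by (rule order_trans[OF Phi_le L1[OF late[OF that]]]) simp
      show "real k + (\<Sum>i<k. C * H i) + 1 \<le> Phi (\<phi> (r k)) y (g k)"
        by (rule y)
    qed
    ultimately show ?thesis
      by simp
  qed
  have "Limsup (at_left 1) (\<lambda>r. SUP y\<in>arc_nbhd (l r) x. ereal (Phi (\<phi> r) y f)) = \<infinity>" (is "?L = \<infinity>") for x
  proof (rule ccontr)
    assume "?L \<noteq> \<infinity>"
    then obtain K :: nat where "?L < ereal (real K)"
      using less_PInf_Ex_of_nat by auto
    then have "\<forall>\<^sub>F r in at_left 1. (SUP y\<in>arc_nbhd (l r) x. ereal (Phi (\<phi> r) y f)) < ereal (real K)"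
      by (rule Limsup_lessD)
    then obtain b where b: "b < 1" "\<And>r. b < r \<Longrightarrow> r < 1 \<Longrightarrow> (SUP y\<in>arc_nbhd (l r) x. ereal (Phi (\<phi> r) y f)) < ereal (real K)"
      by (auto simp: eventually_at_left_field)
    obtain n :: nat where n: "1 / (1 - b) < real n"
      using reals_Archimedean2 by blast
    define k where "k = max n K"
    have "1 / (1 - b) < real (Suc k)"
      using n by (simp add: k_def)
    then have "1 / real (Suc k) < 1 - b"
      using b(1) by (simp add: field_simps)
    then have rk: "b < r k" "r k < 1"
      using r[of k] by auto
    obtain y where y: "y \<in> arc_nbhd (l (r k)) x" "real k + (\<Sum>i<k. C * H i) + 1 \<le> Phi (\<phi> (r k)) y (g k)"
      using peak by blast
    have "ereal (real K) \<le> ereal (Phi (\<phi> (r k)) y f)"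
      using Phi_f[OF y(2)] by (simp add: k_def)
    also have "\<dots> \<le> (SUP y\<in>arc_nbhd (l (r k)) x. ereal (Phi (\<phi> (r k)) y f))"
      using y(1) by (rule SUP_upper)
    also have "\<dots> < ereal (real K)"
      using b(2)[OF rk] .
    finally show False by simp
  qed
  then show ?thesis
    using in_L by blast
qed

end
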